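(* The satisfiability problem of the modal logic $\mathcal{B}(\langle r\rangle,\mathsf{k})$ is undecidable: there is no algorithm which, given as input a formula $\varphi$ of $\mathcal{B}(\langle r\rangle,\mathsf{k})$, decides whether there exist a frame $\mathcal{M}=\langle W,R\rangle$ and a state $w\in W$ such that $\mathcal{M},\emptyset,w\models\varphi$.
   Context: **Syntax.** Formulas of $\mathcal{B}(\langle r\rangle,\mathsf{k})$ are generated by the grammar $F ::= \neg F \mid F_1\wedge F_2 \mid \Diamond F \mid \mathsf{k}$. Here $\Diamond$ is the "remember-and-move" operator $\langle r\rangle$ and $\mathsf{k}$ is the nullary "known" operator. There are no propositional symbols and no nominals; $\mathsf{k}$ is the only atom. **Semantics.** A frame (model) is a pair $\mathcal{M}=\langle W,R\rangle$, where $W$ is a set of states and $R\subseteq W\times W$ is an arbitrary binary relation. Formulas are evaluated at a state $w\in W$ relative to a memory $S\subseteq W$ (the set of visited states): - $\mathcal{M},S,w\models\neg\varphi$ iff $\mathcal{M},S,w\not\models\varphi$; - $\mathcal{M},S,w\models\varphi\wedge\psi$ iff $\mathcal{M},S,w\models\varphi$ and $\mathcal{M},S,w\models\psi$; - $\mathcal{M},S,w\models\Diamond\varphi$ iff there exists $t\in W$ such that $R\,w\,t$ and $\mathcal{M},S\cup\{w\},t\models\varphi$; - $\mathcal{M},S,w\models\mathsf{k}$ iff $w\in S$. **Satisfiability.** A formula $\varphi$ is satisfiable if there exist a frame $\mathcal{M}=\langle W,R\rangle$ and $w\in W$ with $\mathcal{M},\emptyset,w\models\varphi$ (the initial memory is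 empty). Frames may be finite or infinite. *)

theory Defs
  imports "HOL-Library.Nat_Bijection" "HOL-Library.Countable_Set"
begin

section \<open>The logic with remember-and-move and known\<close>

datatype fm = Neg fm | Conj fm fm | Dia fm | Known

type_synonym 'a frame = "'a set \<times> ('a \<times> 'a) set"

fun is_frame :: "'a frame \<Rightarrow> bool" where
  "is_frame (W, R) \<longleftrightarrow> R \<subseteq> W \<times> W"

fun holds :: "'a frame \<Rightarrow> 'a set \<Rightarrow> 'a \<Rightarrow> fm \<Rightarrow> bool" where
  "holds M S w (Neg \<phi>) \<longleftrightarrow> \<not> holds M S w \<phi>"
| "holds M S w (Conj \<phi> \<psi>) \<longleftrightarrow> holds M S w \<phi> \<and> holds M S w \<psi>"
| "holds M S w (Dia \<phi>) \<longleftrightarrow> (\<exists>t \<in> fst M. (w, t) \<in> snd M \<and> holds M (S \<union> {w}) t \<phi>)"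
| "holds M S w Known \<longleftrightarrow> w \<in> S"

text \<open>
  HOL cannot quantify over types inside a formula, so satisfiability takes as a parameter
  the type from which states are drawn. The theorem \<open>satisfiable_transfer\<close> below shows
  that a formula satisfied in some frame over some type is satisfied in a frame over any
  infinite type, so all infinite types yield the same, unrestricted notion.
\<close>

definition satisfiable :: "'a itself \<Rightarrow> fm \<Rightarrow> bool" where
  "satisfiable _ \<phi> \<longleftrightarrow>
     (\<exists>(W :: 'a set) R. is_frame (W, R) \<and> (\<exists>w \<in> W. holds (W, R) {} w \<phi>))"


section \<open>Independence of satisfiability from the infinite type of states\<close>

lemma holds_restrict_iff:
  fixes h :: "'b \<Rightarrow> 'a"
  assumes closed: "\<And>\<phi> S w t. finite S \<Longrightarrow> S \<subseteq> V \<Longrightarrow> w \<in> V \<Longrightarrow> t \<in> W \<Longrightarrow> (w, t) \<in> R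
      \<Longrightarrow> holds (W, R) S t \<phi> \<Longrightarrow> \<exists>t' \<in> V. (w, t') \<in> R \<and> holds (W, R) S t' \<phi>"
    and VW: "V \<subseteq> W" and inj: "inj_on h V"
    and R': "R' = map_prod h h ` (R \<inter> V \<times> V)"
    and "finite S" "S \<subseteq> V" "w \<in> V"
  shows "holds (h ` V, R') (h ` S) (h w) \<phi> \<longleftrightarrow> holds (W, R) S w \<phi>"
  using assms(5-7)
proof (induction \<phi> arbitrary: S w)
  case (Dia \<phi>)
  have R'_iff: "(h w, h t) \<in> R' \<longleftrightarrow> (w, t) \<in> R" if "t \<in> V" for t
  proof
    assume "(h w, h t) \<in> R'"
    then obtain x y where "(x, y) \<in> R" "x \<in> V" "y \<in> V" "h w = h x" "h t = h y"
      unfolding R' by auto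
    then show "(w, t) \<in> R" using inj that Dia.prems(3) by (auto dest: inj_onD)
  next
    assume "(w, t) \<in> R"
    then show "(h w, h t) \<in> R'"
      unfolding R' using that Dia.prems(3) by (intro image_eqI[of _ _ "(w, t)"]) auto
  qed
  have ins: "insert (h w) (h ` S) = h ` insert w S"
    by simp
  have IH: "holds (h ` V, R') (h ` insert w S) (h t) \<phi> \<longleftrightarrow> holds (W, R) (insert w S) t \<phi>"
    if "t \<in> V" for t
    using Dia.IH[of "insert w S" t] Dia.prems that by simp
  have "holds (h ` V, R') (h ` S) (h w) (Dia \<phi>)
      \<longleftrightarrow> (\<exists>t \<in> V. (w, t) \<in> R \<and> holds (W, R) (insert w S) t \<phi>)"
    using R'_iff IH by (simp add: ins del: image_insert)
  also have "\<dots> \<longleftrightarrow> (\<exists>t \<in> W. (w, t) \<in> R \<and> holds (W, R) (insert w S) t \<phi>)"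
    using closed[of "insert w S" w _ \<phi>] Dia.prems VW by blast
  finally show ?case by simp
next
  case Known
  then show ?case using inj by (auto simp: inj_on_def)
qed auto

instance fm :: countable by countable_datatype

datatype witness_term = Base | Wit fm "witness_term list" witness_term

instance witness_term :: countable by countable_datatype

primrec witness_val :: "'a frame \<Rightarrow> 'a \<Rightarrow> witness_term \<Rightarrow> 'a" where
  "witness_val M w Base = w"
| "witness_val M w (Wit \<phi> ts u) =
    (let P = (\<lambda>t. t \<in> fst M \<and> (witness_val M w u, t) \<in> snd M
                \<and> holds M (set (map (witness_val M w) ts)) t \<phi>)
     in if Ex P then Eps P else w)"

theorem satisfiable_transfer:
  assumes "satisfiable TYPE('b) \<phi>" "infinite (UNIV :: 'a set)"
  shows "satisfiable TYPE('a) \<phi>"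
proof -
  obtain W and R :: "('b \<times> 'b) set" and w
    where w: "w \<in> W" "holds (W, R) {} w \<phi>"
    using assms(1) by (auto simp: satisfiable_def)
  let ?v = "witness_val (W, R) w"
  define V where "V = range ?v"
  have "?v u \<in> W" for u
  proof (cases u)
    case (Wit \<psi> ts u')
    let ?P = "\<lambda>t. t \<in> W \<and> (?v u', t) \<in> R \<and> holds (W, R) (set (map ?v ts)) t \<psi>"
    show ?thesis
      using someI_ex[of ?P] w(1) unfolding Wit by (auto simp: Let_def)
  qed (simp add: w(1))
  then have VW: "V \<subseteq> W" by (auto simp: V_def)
  have "w \<in> V" unfolding V_def by (rule range_eqI[of _ _ Base]) simp
  have closed: "\<exists>t' \<in> V. (x, t') \<in> R \<and> holds (W, R) S t' \<psi>"
    if "finite S" "S \<subseteq> V" "x \<in> V" "t \<in> W" "(x, t) \<in> R" "holds (W, R) S t \<psi>" for \<psi> S x t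
  proof -
    obtain u where u: "x = ?v u" using \<open>x \<in> V\<close> by (auto simp: V_def)
    obtain T where "finite T" "S = ?v ` T"
      using finite_subset_image[OF \<open>finite S\<close> \<open>S \<subseteq> V\<close>[unfolded V_def]] by blast
    then obtain ts where ts: "S = set (map ?v ts)"
      by (metis finite_list set_map)
    let ?P = "\<lambda>t. t \<in> W \<and> (?v u, t) \<in> R \<and> holds (W, R) (set (map ?v ts)) t \<psi>"
    have ex: "\<exists>t. ?P t" using that u ts by blast
    then have "?v (Wit \<psi> ts u) = Eps ?P" by (simp add: Let_def)
    with someI_ex[OF ex] have "?P (?v (Wit \<psi> ts u))" by simp
    moreover have "?v (Wit \<psi> ts u) \<in> V" unfolding V_def by (rule rangeI)
    ultimately show ?thesis unfolding u ts by blast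
  qed
  obtain g :: "nat \<Rightarrow> 'a" where g: "inj g"
    using infinite_countable_subset[OF assms(2)] by blast
  have "countable V" by (simp add: V_def)
  then have inj: "inj_on (g \<circ> to_nat_on V) V"
    using g by (intro comp_inj_on) (auto intro: inj_on_subset)
  define h where "h = g \<circ> to_nat_on V"
  let ?R = "map_prod h h ` (R \<inter> V \<times> V)"
  have "holds (h ` V, ?R) (h ` {}) (h w) \<phi> \<longleftrightarrow> holds (W, R) {} w \<phi>"
    by (rule holds_restrict_iff[OF _ VW inj[folded h_def] refl])
      (rule closed; assumption | simp add: \<open>w \<in> V\<close>)+
  then have "holds (h ` V, ?R) {} (h w) \<phi>" using w(2) by simp
  moreover have "is_frame (h ` V, ?R)" by auto
  ultimately show ?thesis using \<open>w \<in> V\<close> unfolding satisfiable_def by blast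
qed


section \<open>Partial recursive functions\<close>

text \<open>
  Kleene's partial recursive functions. Arities are left implicit: the length of the argument
  list given to a term determines that of every subterm, and an evaluation that does not fit
  has no value. \<open>Prim\<close> recurses on the first argument and passes its step function the
  predecessor and the previous value in front of the parameters; \<open>Mu\<close> searches for the
  least first argument at which its argument vanishes and is undefined if the search meets an
  undefined value.
\<close>

datatype recf = Zero | Succ | Proj nat | Comp recf "recf list" | Prim recf recf | Mu recf

inductive computes :: "recf \<Rightarrow> nat list \<Rightarrow> nat \<Rightarrow> bool" where
  zero: "computes Zero xs 0"
| succ: "computes Succ [x] (Suc x)"
| proj: "i < length xs \<Longrightarrow> computes (Proj i) xs (xs ! i)"
| comp: "list_all2 (\<lambda>g y. computes g xs y) gs ys \<Longrightarrow> computes f ys z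
    \<Longrightarrow> computes (Comp f gs) xs z"
| prim_0: "computes f xs y \<Longrightarrow> computes (Prim f g) (0 # xs) y"
| prim_Suc: "computes (Prim f g) (n # xs) r \<Longrightarrow> computes g (n # r # xs) y
    \<Longrightarrow> computes (Prim f g) (Suc n # xs) y"
| mu: "computes f (n # xs) 0 \<Longrightarrow> (\<And>m. m < n \<Longrightarrow> \<exists>y. computes f (m # xs) (Suc y))
    \<Longrightarrow> computes (Mu f) xs n"

inductive_cases computes_elims:
  "computes Zero xs z" "computes Succ xs z" "computes (Proj i) xs z" "computes (Comp f gs) xs z"
  "computes (Prim f g) (0 # xs) z" "computes (Prim f g) (Suc n # xs) z" "computes (Mu f) xs z"

theorem computes_deterministic:
  "computes f xs y \<Longrightarrow> computes f xs z \<Longrightarrow> y = z"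
proof (induction arbitrary: z rule: computes.induct)
  case (comp xs gs ys f y)
  from comp.prems obtain ys' where ys': "list_all2 (\<lambda>g y. computes g xs y) gs ys'"
    and z: "computes f ys' z"
    by (rule computes_elims(4))
  have "ys = ys'"
    using comp.IH(1) ys' by (auto simp: list_all2_conv_all_nth intro!: nth_equalityI)
  then show ?case using comp.IH(2) z by simp
next
  case (prim_Suc f g n xs r y)
  from prim_Suc.prems obtain r' where "computes (Prim f g) (n # xs) r'"
    "computes g (n # r' # xs) z"
    by (rule computes_elims(6))
  with prim_Suc.IH show ?case by simp
next
  case (mu f n xs)
  from mu.prems obtain z: "computes f (z # xs) 0"
    and less: "\<And>m. m < z \<Longrightarrow> \<exists>y. computes f (m # xs) (Suc y)"
    by (rule computes_elims(7)) blast
  show ?case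
  proof (rule linorder_cases[of n z])
    assume "n < z"
    with less obtain y where "computes f (n # xs) (Suc y)" by blast
    with mu.IH(1) show ?thesis by fastforce
  next
    assume "z < n"
    with mu.IH(2) obtain y where "\<And>u. computes f (z # xs) u \<Longrightarrow> Suc y = u" by blast
    with z show ?thesis by fastforce
  qed
next
  case zero
  then show ?case by (rule computes_elims(1)) simp
next
  case succ
  then show ?case by (rule computes_elims(2)) simp
next
  case proj
  from proj(2) show ?case by (rule computes_elims(3)) simp
next
  case prim_0
  from prim_0.prems show ?case by (rule computes_elims(5)) (rule prim_0.IH)
qed


section \<open>Decidability of properties of formulas\<close>

primrec code :: "fm \<Rightarrow> nat" where
  "code Known = 0"
| "code (Neg \<phi>) = Suc (3 * code \<phi>)"
| "code (Dia \<phi>) = Suc (3 * code \<phi> + 1)"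
| "code (Conj \<phi> \<psi>) = Suc (3 * prod_encode (code \<phi>, code \<psi>) + 2)"

theorem bij_code: "bij code"
proof (rule bijI)
  have neq: "3 * a \<noteq> Suc (3 * b)" "3 * a \<noteq> Suc (Suc (3 * b))" for a b :: nat
    by presburger+
  have "code \<phi> = code \<psi> \<Longrightarrow> \<phi> = \<psi>" for \<phi> \<psi>
  proof (induction \<phi> arbitrary: \<psi>)
    case (Neg \<phi>)
    then show ?case by (cases \<psi>) (auto simp: neq)
  next
    case (Conj \<phi>1 \<phi>2)
    then show ?case by (cases \<psi>) (auto simp: neq neq[symmetric] prod_encode_eq)
  next
    case (Dia \<phi>)
    then show ?case by (cases \<psi>) (auto simp: neq neq[symmetric])
  next
    case Known
    then show ?case by (cases \<psi>) auto
  qed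
  then show "inj code" by (rule injI)
  have "\<exists>\<phi>. n = code \<phi>" for n
  proof (induction n rule: less_induct)
    case (less n)
    show ?case
    proof (cases n)
      case 0
      then show ?thesis by (metis code.simps(1))
    next
      case (Suc m)
      define q where "q = m div 3"
      have q: "q < n" using Suc by (simp add: q_def)
      consider "n = Suc (3 * q)" | "n = Suc (3 * q + 1)" | "n = Suc (3 * q + 2)"
        using Suc mult_div_mod_eq[of 3 m] mod_less_divisor[of 3 m]
        unfolding q_def by linarith
      then show ?thesis
      proof cases
        case 1
        then show ?thesis using less.IH[OF q] by (metis code.simps(2))
      next
        case 2
        then show ?thesis using less.IH[OF q] by (metis code.simps(3))
      next
        case 3
        obtain a b where ab: "q = prod_encode (a, b)"
          by (metis prod_decode_inverse surj_pair)
        then have "a < n" "b < n"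
          using q le_prod_encode_1[of a b] le_prod_encode_2[of b a] by linarith+
        then show ?thesis using less.IH 3 ab by (metis code.simps(4))
      qed
    qed
  qed
  then show "surj code" by (auto simp: surj_def)
qed

definition decidable :: "(fm \<Rightarrow> bool) \<Rightarrow> bool" where
  "decidable P \<longleftrightarrow> (\<exists>f. \<forall>\<phi>. computes f [code \<phi>] (if P \<phi> then 1 else 0))"

end

theory Submission
  imports Defs
begin

text \<open>
  The graph of a partial recursive function is definable by finitely many Horn rules over
  environments \<open>nat \<Rightarrow> nat\<close> that only combine labels of one environment or pass a label along the
  increment of one variable. A finite set of such rules using \<open>k\<close> variables becomes a formula
  whose intended model is the \<open>k\<close>-dimensional grid of environments together with a root that
  sees, and is seen by, every grid point. The memory expresses that the \<open>k\<close> successor relations of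
  the grid are functional and commute, so in every model of the formula the forced labels are
  present. For every function \<open>f\<close> this gives a formula \<open>\<theta>\<close> and simple formulas for the inputs
  \<open>n\<close> such that their conjunction is satisfiable iff \<open>f\<close> does not map \<open>n\<close> to \<open>1\<close>. If a function \<open>d\<close>
  decided satisfiability, this construction, applied to the function that maps the code of \<open>\<theta>\<close>
  to the verdict of \<open>d\<close> on \<open>\<theta>\<close> with its own code as input, would give a contradiction.
\<close>

section \<open>Horn rules over environments\<close>

type_synonym env = "nat \<Rightarrow> nat"

text \<open>There is no separate copying rule: \<open>And a a b\<close> carries label
  \<open>a\<close> over to \<open>b\<close>.\<close>

datatype 'l rule = And 'l 'l 'l | Up nat 'l 'l | Down nat 'l 'l | Start 'l

definition incr :: "nat \<Rightarrow> env \<Rightarrow> env" where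
  "incr i \<nu> = \<nu>(i := Suc (\<nu> i))"

lemma incr_upd: "incr i (\<nu>(i := m)) = \<nu>(i := Suc m)"
  by (simp add: incr_def)

fun closed :: "(env \<times> 'l) set \<Rightarrow> 'l rule \<Rightarrow> bool" where
  "closed L (And a b c) \<longleftrightarrow> (\<forall>\<nu>. (\<nu>, a) \<in> L \<and> (\<nu>, b) \<in> L \<longrightarrow> (\<nu>, c) \<in> L)"
| "closed L (Up i a b) \<longleftrightarrow> (\<forall>\<nu>. (\<nu>, a) \<in> L \<longrightarrow> (incr i \<nu>, b) \<in> L)"
| "closed L (Down i a b) \<longleftrightarrow> (\<forall>\<nu>. (incr i \<nu>, a) \<in> L \<longrightarrow> (\<nu>, b) \<in> L)"
| "closed L (Start a) \<longleftrightarrow> (\<lambda>_. 0, a) \<in> L"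

declare closed.simps [simp del]

lemma closed_AndD: "closed L (And a b c) \<Longrightarrow> (\<nu>, a) \<in> L \<Longrightarrow> (\<nu>, b) \<in> L \<Longrightarrow> (\<nu>, c) \<in> L"
  and closed_UpD: "closed L (Up i a b) \<Longrightarrow> (\<nu>, a) \<in> L \<Longrightarrow> (incr i \<nu>, b) \<in> L"
  and closed_DownD: "closed L (Down i a b) \<Longrightarrow> (incr i \<nu>, a) \<in> L \<Longrightarrow> (\<nu>, b) \<in> L"
  and closed_StartD: "closed L (Start a) \<Longrightarrow> (\<lambda>_. 0, a) \<in> L"
  by (auto simp: closed.simps)

fun dims_below :: "nat \<Rightarrow> 'l rule \<Rightarrow> bool" where
  "dims_below k (Up i a b) \<longleftrightarrow> i < k"
| "dims_below k (Down i a b) \<longleftrightarrow> i < k"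
| "dims_below k _ \<longleftrightarrow> True"

text \<open>Renaming labels means pulling the relation back along \<open>f\<close>; this later turns
  labels that are sets into numbers.\<close>

lemma closed_map_rule: "closed L (map_rule f r) \<longleftrightarrow> closed {(\<nu>, a). (\<nu>, f a) \<in> L} r"
  by (cases r) (auto simp: closed.simps)

lemma closed_cong:
  assumes "\<And>\<nu> a. a \<in> set_rule r \<Longrightarrow> (\<nu>, a) \<in> L \<longleftrightarrow> (\<nu>, a) \<in> L'"
  shows "closed L r \<longleftrightarrow> closed L' r"
  using assms by (cases r) (auto simp: closed.simps)

lemma dims_below_map_rule [simp]: "dims_below k (map_rule f r) \<longleftrightarrow> dims_below k r"
  by (cases r) auto

lemma eventually_dims_below: "\<forall>\<^sub>F k in sequentially. dims_below k r"
  by (cases r) (auto intro: eventually_gt_at_top)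

text \<open>
  Using the predicates themselves as labels makes rule sets for different predicates
  compatible: their union is sound again, and no fresh labels are ever needed.
\<close>

abbreviation sound :: "env set rule \<Rightarrow> bool" where
  "sound \<equiv> closed {(\<nu>, A). \<nu> \<in> A}"

text \<open>In \<open>k\<close> dimensions these are the environments reachable from the origin by
  \<open>incr\<close>, so completeness of rules is demanded for them alone.\<close>

definition supported :: "nat \<Rightarrow> env \<Rightarrow> bool" where
  "supported k \<nu> \<longleftrightarrow> (\<forall>i\<ge>k. \<nu> i = 0)"

lemma supported_upd: "supported k \<nu> \<Longrightarrow> i < k \<Longrightarrow> supported k (\<nu>(i := m))"
  by (simp add: supported_def)

definition forces :: "nat \<Rightarrow> env set rule set \<Rightarrow> env set \<Rightarrow> bool" where
  "forces k T A \<longleftrightarrow> (\<forall>L. (\<forall>r \<in> T. closed L r) \<longrightarrow> (\<forall>\<nu>. supported k \<nu> \<longrightarrow> \<nu> \<in> A \<longrightarrow> (\<nu>, A) \<in> L))"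

text \<open>Asking only for all large \<open>k\<close> lets rule sets with different auxiliary
  variables be merged without computing a common dimension.\<close>

definition horn_def :: "env set \<Rightarrow> bool" where
  "horn_def A \<longleftrightarrow> (\<forall>\<^sub>F k in sequentially. \<exists>T. finite T \<and> (\<forall>r \<in> T. dims_below k r \<and> sound r) \<and> forces k T A)"

text \<open>The recipe behind most results below: keep the rules of the auxiliary predicates
  \<open>H\<close>, add \<open>T0\<close>, and check that the new label is derived. The union stays
  sound because every label means itself, and finitely many conditions on large \<open>k\<close>
  hold together.\<close>

lemma horn_def_by_rules:
  assumes H: "finite H" "\<And>B. B \<in> H \<Longrightarrow> horn_def B"
    and T0: "finite T0" "\<And>r. r \<in> T0 \<Longrightarrow> sound r"
    and step: "\<And>k L \<nu>. \<lbrakk>\<forall>r \<in> T0. dims_below k r; \<forall>r \<in> T0. closed L r;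
      \<And>B \<nu>. B \<in> H \<Longrightarrow> supported k \<nu> \<Longrightarrow> \<nu> \<in> B \<Longrightarrow> (\<nu>, B) \<in> L; supported k \<nu>; \<nu> \<in> A\<rbrakk> \<Longrightarrow> (\<nu>, A) \<in> L"
  shows "horn_def A"
proof -
  have "\<forall>\<^sub>F k in sequentially. \<forall>B \<in> H. \<exists>T. finite T \<and> (\<forall>r \<in> T. dims_below k r \<and> sound r) \<and> forces k T B"
    using H by (intro eventually_ball_finite) (auto simp: horn_def_def)
  moreover have "\<forall>\<^sub>F k in sequentially. \<forall>r \<in> T0. dims_below k r"
    using T0(1) by (intro eventually_ball_finite) (auto intro: eventually_dims_below)
  ultimately show ?thesis
    unfolding horn_def_def
  proof eventually_elim
    case (elim k)
    then obtain T where T: "\<forall>B \<in> H. finite (T B) \<and> (\<forall>r \<in> T B. dims_below k r \<and> sound r) \<and> forces k (T B) B"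
      by metis
    have "forces k (T0 \<union> (\<Union>B \<in> H. T B)) A"
      unfolding forces_def
    proof (intro allI impI)
      fix L \<nu> assume L: "\<forall>r \<in> T0 \<union> (\<Union>B \<in> H. T B). closed L r" and \<nu>: "supported k \<nu>" "\<nu> \<in> A"
      show "(\<nu>, A) \<in> L"
      proof (rule step[of k L \<nu>])
        fix B \<mu> assume "B \<in> H" "supported k \<mu>" "\<mu> \<in> B"
        with L T show "(\<mu>, B) \<in> L" unfolding forces_def by (metis UN_I UnI2)
      qed (use elim L \<nu> in auto)
    qed
    with T T0 H elim show ?case
      by (intro exI[of _ "T0 \<union> (\<Union>B \<in> H. T B)"]) auto
  qed
qed

section \<open>Basic Horn definable sets and closure under logical operations\<close>

lemma horn_def_empty: "horn_def {}"
  by (rule horn_def_by_rules[of "{}" "{}"]) auto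

text \<open>Induction on the sum of the first \<open>k\<close> coordinates: a nonzero one can be
  lowered by one.\<close>

lemma supported_induct [consumes 1, case_names zero incr]:
  assumes "supported k \<nu>" "P (\<lambda>_. 0)" "\<And>i \<nu>. i < k \<Longrightarrow> P \<nu> \<Longrightarrow> P (incr i \<nu>)"
  shows "P \<nu>"
  using assms(1)
proof (induction "\<Sum>i<k. \<nu> i" arbitrary: \<nu>)
  case 0
  then have "\<nu> = (\<lambda>_. 0)" by (auto simp: supported_def fun_eq_iff not_less[symmetric])
  with assms(2) show ?case by simp
next
  case (Suc n)
  obtain i where i: "i < k" "\<nu> i \<noteq> 0"
    using Suc.hyps(2) by (metis lessThan_iff nat.distinct(1) sum.neutral)
  let ?\<mu> = "\<nu>(i := \<nu> i - 1)"
  have "(\<Sum>j<k. \<nu> j) = \<nu> i + (\<Sum>j \<in> {..<k} - {i}. \<nu> j)"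
    using i by (simp add: sum.remove)
  moreover have "(\<Sum>j<k. ?\<mu> j) = \<nu> i - 1 + (\<Sum>j \<in> {..<k} - {i}. \<nu> j)"
    using i by (simp add: sum.remove)
  ultimately have "n = (\<Sum>j<k. ?\<mu> j)" using Suc.hyps(2) i by simp
  moreover have "supported k ?\<mu>" using Suc.prems i(1) by (rule supported_upd)
  ultimately have "P ?\<mu>" by (rule Suc.hyps(1))
  then have "P (incr i ?\<mu>)" by (rule assms(3)[OF i(1)])
  then show ?case using i by (simp add: incr_def)
qed

text \<open>The label must reach the whole grid, which takes one \<open>Up\<close> rule per
  direction below \<open>k\<close>. These rules vary with \<open>k\<close>, so the definition is
  checked directly instead of through \<open>horn_def_by_rules\<close>.\<close>

lemma horn_def_UNIV: "horn_def UNIV"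
proof -
  have "\<exists>T. finite T \<and> (\<forall>r \<in> T. dims_below k r \<and> sound r) \<and> forces k T UNIV" for k
  proof (intro exI conjI)
    let ?T = "insert (Start UNIV) ((\<lambda>i. Up i UNIV UNIV) ` {..<k})"
    show "finite ?T" "\<forall>r \<in> ?T. dims_below k r \<and> sound r" by (auto simp: closed.simps)
    show "forces k ?T UNIV"
      unfolding forces_def
    proof (intro allI impI)
      fix L \<nu> assume L: "\<forall>r \<in> ?T. closed L r" and \<nu>: "supported k \<nu>" "\<nu> \<in> UNIV"
      have st: "closed L (Start UNIV)" and up: "i < k \<Longrightarrow> closed L (Up i UNIV UNIV)" for i
        using L by simp_all
      from \<nu>(1) show "(\<nu>, UNIV) \<in> L"
      proof (induction rule: supported_induct)
        case (incr i \<nu>)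
        from closed_UpD[OF up[OF incr(1)] incr(2)] show ?case .
      qed (rule closed_StartD[OF st])
    qed
  qed
  then show ?thesis by (simp add: horn_def_def)
qed

text \<open>As for \<open>UNIV\<close>, but without direction \<open>i\<close>, so that the label
  spreads from the origin without leaving the hyperplane.\<close>

lemma horn_def_zero: "horn_def {\<nu>. \<nu> i = 0}" (is "horn_def ?Z")
proof -
  have "\<exists>T. finite T \<and> (\<forall>r \<in> T. dims_below k r \<and> sound r) \<and> forces k T ?Z" for k
  proof (intro exI conjI)
    let ?T = "insert (Start ?Z) ((\<lambda>j. Up j ?Z ?Z) ` ({..<k} - {i}))"
    show "finite ?T" "\<forall>r \<in> ?T. dims_below k r \<and> sound r" by (auto simp: incr_def closed.simps)
    show "forces k ?T ?Z"
      unfolding forces_def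
    proof (intro allI impI)
      fix L \<nu> assume L: "\<forall>r \<in> ?T. closed L r" and \<nu>: "supported k \<nu>" "\<nu> \<in> ?Z"
      from \<nu>(1) have "\<nu> i = 0 \<longrightarrow> (\<nu>, ?Z) \<in> L"
      proof (induction rule: supported_induct)
        case (incr j \<nu>)
        show ?case
        proof (cases "j = i")
          case False
          have "(incr j \<nu>) i = \<nu> i" using False by (simp add: incr_def)
          moreover have up: "closed L (Up j ?Z ?Z)" using L incr(1) False by simp
          ultimately show ?thesis using incr(2) closed_UpD[OF up] by metis
        qed (simp add: incr_def)
      next
        case zero
        have "closed L (Start ?Z)" using L by simp
        from closed_StartD[OF this] show ?case ..
      qed
      with \<nu>(2) show "(\<nu>, ?Z) \<in> L" by simp
    qed
  qed
  then show ?thesis by (simp add: horn_def_def)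
qed

lemma horn_def_Int:
  assumes "horn_def A" "horn_def B"
  shows "horn_def (A \<inter> B)"
proof (rule horn_def_by_rules[of "{A, B}" "{And A B (A \<inter> B)}"])
  fix k L \<nu>
  assume L: "\<forall>r \<in> {And A B (A \<inter> B)}. closed L r"
    and H: "\<And>C \<nu>. C \<in> {A, B} \<Longrightarrow> supported k \<nu> \<Longrightarrow> \<nu> \<in> C \<Longrightarrow> (\<nu>, C) \<in> L"
    and \<nu>: "supported k \<nu>" "\<nu> \<in> A \<inter> B"
  have "closed L (And A B (A \<inter> B))" using L by simp
  then show "(\<nu>, A \<inter> B) \<in> L" by (rule closed_AndD) (use \<nu> in \<open>auto intro!: H\<close>)
qed (use assms in \<open>auto simp: closed.simps\<close>)

text \<open>Spreading a label both ways along axis \<open>i\<close> amounts to quantifying variable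
  \<open>i\<close> existentially. The rules have a name of their own because primitive recursion
  applies them to labels that are still being derived.\<close>

definition project_rules :: "nat \<Rightarrow> 'l \<Rightarrow> 'l \<Rightarrow> 'l rule set" where
  "project_rules i A B = {And A A B, Up i B B, Down i B B}"

lemma project_rulesD:
  assumes "\<forall>r \<in> project_rules i A B. closed L r" "(\<nu>(i := m), A) \<in> L"
  shows "(\<nu>, B) \<in> L"
proof -
  have "closed L (And A A B)" "closed L (Up i B B)" "closed L (Down i B B)"
    using assms(1) unfolding project_rules_def by blast+
  note cl = closed_AndD[OF this(1)] closed_UpD[OF this(2)] closed_DownD[OF this(3)]
  from assms(2) have "(\<nu>(i := m), B) \<in> L" by (rule cl(1)) (rule assms(2))
  \<comment> \<open>The label travels down to coordinate \<open>0\<close> first and from there up to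
    any value.\<close>
  then have "(\<nu>(i := 0), B) \<in> L"
  proof (induction m)
    case (Suc m)
    have "(\<nu>(i := m), B) \<in> L" by (rule cl(3)) (use Suc.prems in \<open>simp only: incr_upd\<close>)
    then show ?case by (rule Suc.IH)
  qed
  then have "(\<nu>(i := n), B) \<in> L" for n
  proof (induction n)
    case (Suc n)
    from cl(2)[OF Suc.IH[OF Suc.prems]] show ?case by (simp only: incr_upd)
  qed
  from this[of "\<nu> i"] show ?thesis by simp
qed

lemma project_rules_sound:
  assumes "\<And>\<nu>. \<nu> \<in> A \<Longrightarrow> \<nu> \<in> B" "\<And>\<nu> m. \<nu>(i := m) \<in> B \<longleftrightarrow> \<nu> \<in> B" "r \<in> project_rules i A B"
  shows "sound r"
  using assms by (auto simp: project_rules_def incr_def closed.simps)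

lemma finite_project_rules [simp]: "finite (project_rules i A B)"
  by (simp add: project_rules_def)

lemma dims_below_project_rules: "\<forall>r \<in> project_rules i A B. dims_below k r \<Longrightarrow> i < k"
  by (simp add: project_rules_def)

lemma horn_def_project:
  assumes "horn_def A"
  shows "horn_def {\<nu>. \<exists>m. \<nu>(i := m) \<in> A}" (is "horn_def ?B")
proof (rule horn_def_by_rules[of "{A}" "project_rules i A ?B"])
  show "sound r" if "r \<in> project_rules i A ?B" for r
  proof (rule project_rules_sound[OF _ _ that])
    fix \<nu> assume "\<nu> \<in> A"
    then have "\<nu>(i := \<nu> i) \<in> A" by simp
    then show "\<nu> \<in> ?B" by blast
  qed simp
next
  fix k L \<nu>
  assume d: "\<forall>r \<in> project_rules i A ?B. dims_below k r" and L: "\<forall>r \<in> project_rules i A ?B. closed L r"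
    and A: "\<And>B \<nu>. B \<in> {A} \<Longrightarrow> supported k \<nu> \<Longrightarrow> \<nu> \<in> B \<Longrightarrow> (\<nu>, B) \<in> L"
    and \<nu>: "supported k \<nu>" "\<nu> \<in> ?B"
  obtain m where "\<nu>(i := m) \<in> A" using \<nu> by auto
  moreover have "supported k (\<nu>(i := m))"
    using \<nu>(1) dims_below_project_rules[OF d] by (rule supported_upd)
  ultimately have "(\<nu>(i := m), A) \<in> L" by (intro A) simp_all
  with L show "(\<nu>, ?B) \<in> L" by (rule project_rulesD)
qed (use assms in auto)

lemma horn_def_project_set:
  assumes "finite J" "horn_def A"
  shows "horn_def {\<nu>. \<exists>\<mu> \<in> A. \<forall>i. i \<notin> J \<longrightarrow> \<mu> i = \<nu> i}"
  using assms
proof (induction J)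
  case empty
  have "{\<nu>. \<exists>\<mu> \<in> A. \<forall>i. i \<notin> {} \<longrightarrow> \<mu> i = \<nu> i} = A" by (auto simp flip: fun_eq_iff)
  with empty show ?case by simp
next
  case (insert j J)
  have "{\<nu>. \<exists>\<mu> \<in> A. \<forall>i. i \<notin> insert j J \<longrightarrow> \<mu> i = \<nu> i}
      = {\<nu>. \<exists>m. \<nu>(j := m) \<in> {\<nu>. \<exists>\<mu> \<in> A. \<forall>i. i \<notin> J \<longrightarrow> \<mu> i = \<nu> i}}" (is "?l = ?r")
  proof (intro set_eqI iffI)
    fix \<nu> assume "\<nu> \<in> ?l"
    then obtain \<mu> where "\<mu> \<in> A" "\<forall>i. i \<notin> insert j J \<longrightarrow> \<mu> i = \<nu> i" by auto
    then show "\<nu> \<in> ?r" by (intro CollectI exI[of _ "\<mu> j"] bexI[of _ \<mu>]) auto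
  next
    fix \<nu> assume "\<nu> \<in> ?r"
    then obtain m \<mu> where "\<mu> \<in> A" "\<forall>i. i \<notin> J \<longrightarrow> \<mu> i = (\<nu>(j := m)) i" by blast
    then show "\<nu> \<in> ?l" by (intro CollectI bexI[of _ \<mu>]) auto
  qed
  with horn_def_project[OF insert.IH[OF insert.prems]] show ?case by simp
qed

text \<open>A single \<open>Down\<close> rule pulls the label back across one increment.
  Minimisation uses this to say that a value is positive.\<close>

lemma horn_def_incr_vimage:
  assumes "horn_def A"
  shows "horn_def {\<nu>. incr i \<nu> \<in> A}" (is "horn_def ?B")
proof (rule horn_def_by_rules[of "{A}" "{Down i A ?B}"])
  fix k L \<nu>
  assume d: "\<forall>r \<in> {Down i A ?B}. dims_below k r" and L: "\<forall>r \<in> {Down i A ?B}. closed L r"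
    and A: "\<And>B \<nu>. B \<in> {A} \<Longrightarrow> supported k \<nu> \<Longrightarrow> \<nu> \<in> B \<Longrightarrow> (\<nu>, B) \<in> L"
    and \<nu>: "supported k \<nu>" "\<nu> \<in> ?B"
  have "supported k (incr i \<nu>)" using \<nu> d by (simp add: supported_def incr_def)
  then have "(incr i \<nu>, A) \<in> L" using \<nu> by (intro A) simp_all
  moreover have "closed L (Down i A ?B)" using L by simp
  ultimately show "(\<nu>, ?B) \<in> L" using closed_DownD by metis
qed (use assms in \<open>auto simp: closed.simps\<close>)

text \<open>The diagonal is traced in half steps: starting where both coordinates vanish,
  \<open>i\<close> grows first, which leads to \<open>?S\<close>, and then \<open>j\<close>, which
  leads back to \<open>?E\<close>.\<close>

lemma horn_def_eq: "horn_def {\<nu>. \<nu> i = \<nu> j}"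
proof (cases "i = j")
  case True
  then show ?thesis using horn_def_UNIV by simp
next
  case False
  let ?E = "{\<nu>. \<nu> i = \<nu> j}" and ?S = "{\<nu>. \<nu> i = Suc (\<nu> j)}"
  let ?Z = "{\<nu>. \<nu> i = 0} \<inter> {\<nu>. \<nu> j = (0 :: nat)}"
  show ?thesis
  proof (rule horn_def_by_rules[of "{?Z}" "{And ?Z ?Z ?E, Up i ?E ?S, Up j ?S ?E}"])
    fix k L \<nu>
    assume d: "\<forall>r \<in> {And ?Z ?Z ?E, Up i ?E ?S, Up j ?S ?E}. dims_below k r"
      and L: "\<forall>r \<in> {And ?Z ?Z ?E, Up i ?E ?S, Up j ?S ?E}. closed L r"
      and Z: "\<And>B \<nu>. B \<in> {?Z} \<Longrightarrow> supported k \<nu> \<Longrightarrow> \<nu> \<in> B \<Longrightarrow> (\<nu>, B) \<in> L"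
      and \<nu>: "supported k \<nu>" "\<nu> \<in> ?E"
    have "closed L (And ?Z ?Z ?E)" "closed L (Up i ?E ?S)" "closed L (Up j ?S ?E)"
      using L by simp_all
    note cl = closed_AndD[OF this(1)] closed_UpD[OF this(3) closed_UpD[OF this(2)]]
    have "supported k \<nu> \<Longrightarrow> \<nu> i = n \<Longrightarrow> \<nu> j = n \<Longrightarrow> (\<nu>, ?E) \<in> L" for n
    proof (induction n arbitrary: \<nu>)
      case 0
      then have "(\<nu>, ?Z) \<in> L" by (intro Z) auto
      then show ?case by (rule cl(1)) fact
    next
      case (Suc n)
      let ?\<mu> = "\<nu>(i := n, j := n)"
      have "supported k ?\<mu>" using Suc.prems(1) d by (intro supported_upd) auto
      then have "(?\<mu>, ?E) \<in> L" by (rule Suc.IH) (use False in simp_all)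
      then have "(incr j (incr i ?\<mu>), ?E) \<in> L" by (rule cl(2))
      moreover have "incr j (incr i ?\<mu>) = \<nu>" using Suc.prems False by (simp add: incr_def fun_eq_iff)
      ultimately show ?case by simp
    qed
    with \<nu> show "(\<nu>, ?E) \<in> L" by simp
  qed (use False horn_def_Int[OF horn_def_zero horn_def_zero, of i j]
      in \<open>auto simp: incr_def closed.simps\<close>)
qed

lemma horn_def_Suc_eq:
  assumes "i \<noteq> j"
  shows "horn_def {\<nu>. \<nu> i = Suc (\<nu> j)}" (is "horn_def ?S")
proof (rule horn_def_by_rules[of "{{\<nu>. \<nu> i = \<nu> j}}" "{Up i {\<nu>. \<nu> i = \<nu> j} ?S}"])
  fix k L \<nu>
  assume d: "\<forall>r \<in> {Up i {\<nu>. \<nu> i = \<nu> j} ?S}. dims_below k r"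
    and L: "\<forall>r \<in> {Up i {\<nu>. \<nu> i = \<nu> j} ?S}. closed L r"
    and E: "\<And>B \<nu>. B \<in> {{\<nu>. \<nu> i = \<nu> j}} \<Longrightarrow> supported k \<nu> \<Longrightarrow> \<nu> \<in> B \<Longrightarrow> (\<nu>, B) \<in> L"
    and \<nu>: "supported k \<nu>" "\<nu> \<in> ?S"
  have "(\<nu>(i := \<nu> j), {\<nu>. \<nu> i = \<nu> j}) \<in> L"
    using d assms supported_upd[OF \<nu>(1), of i] by (intro E) simp_all
  moreover have "closed L (Up i {\<nu>. \<nu> i = \<nu> j} ?S)" using L by simp
  ultimately have "(incr i (\<nu>(i := \<nu> j)), ?S) \<in> L" by (rule closed_UpD[rotated])
  moreover have "incr i (\<nu>(i := \<nu> j)) = \<nu>" using \<nu> assms by (simp add: incr_def fun_eq_iff)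
  ultimately show "(\<nu>, ?S) \<in> L" by simp
qed (use assms in \<open>auto simp: incr_def closed.simps intro: horn_def_eq\<close>)

lemma horn_def_INT:
  assumes "finite I" "\<And>i. i \<in> I \<Longrightarrow> horn_def (A i)"
  shows "horn_def (\<Inter>i \<in> I. A i)"
  using assms by (induction I) (auto intro: horn_def_UNIV horn_def_Int)


section \<open>Horn definability of the partial recursive functions\<close>

text \<open>\<open>I\<close> names the variables that hold the arguments and \<open>j\<close> the
  one that holds the value. Repetitions are allowed, which is why several constructions below pass
  to fresh variables.\<close>

definition graph :: "recf \<Rightarrow> nat list \<Rightarrow> nat \<Rightarrow> env set" where
  "graph f I j = {\<nu>. computes f (map \<nu> I) (\<nu> j)}"

lemma map_fun_upd_notin [simp]: "i \<notin> set I \<Longrightarrow> map (\<nu>(i := m)) I = map \<nu> I"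
  by auto

text \<open>Composition is existential quantification over the intermediate values, kept in the
  fresh block \<open>J\<close> of variables.\<close>

lemma horn_def_graph_Comp:
  assumes f: "\<And>I j. horn_def (graph f I j)"
    and gs: "\<And>g I j. g \<in> set gs \<Longrightarrow> horn_def (graph g I j)"
  shows "horn_def (graph (Comp f gs) I j)"
proof -
  obtain n where less: "\<forall>i \<in> set (j # I). i < n"
    using finite_nat_set_iff_bounded[of "set (j # I)"] by auto
  define J where "J = [n..<n + length gs]"
  have disj: "j \<notin> set J" "set I \<inter> set J = {}" using less by (force simp: J_def)+
  let ?A = "(\<Inter>i \<in> {..<length gs}. graph (gs ! i) I (n + i)) \<inter> graph f J j"
  have "horn_def ?A"
    by (intro horn_def_Int horn_def_INT f gs) auto
  then have "horn_def {\<nu>. \<exists>\<mu> \<in> ?A. \<forall>i. i \<notin> set J \<longrightarrow> \<mu> i = \<nu> i}"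
    by (intro horn_def_project_set) auto
  also have "{\<nu>. \<exists>\<mu> \<in> ?A. \<forall>i. i \<notin> set J \<longrightarrow> \<mu> i = \<nu> i} = graph (Comp f gs) I j"
  proof (intro set_eqI iffI)
    fix \<nu> assume "\<nu> \<in> {\<nu>. \<exists>\<mu> \<in> ?A. \<forall>i. i \<notin> set J \<longrightarrow> \<mu> i = \<nu> i}"
    then obtain \<mu> where \<mu>: "\<mu> \<in> ?A" and eq: "\<And>i. i \<notin> set J \<Longrightarrow> \<mu> i = \<nu> i" by auto
    have I: "map \<mu> I = map \<nu> I" using eq disj by auto
    have "list_all2 (\<lambda>g y. computes g (map \<nu> I) y) gs (map \<mu> J)"
      using \<mu> I by (auto simp: list_all2_conv_all_nth J_def graph_def)
    moreover have "computes f (map \<mu> J) (\<nu> j)" using \<mu> eq disj by (auto simp: graph_def)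
    ultimately show "\<nu> \<in> graph (Comp f gs) I j" by (auto simp: graph_def intro: computes.comp)
  next
    fix \<nu> assume "\<nu> \<in> graph (Comp f gs) I j"
    then obtain ys where ys: "list_all2 (\<lambda>g y. computes g (map \<nu> I) y) gs ys" "computes f ys (\<nu> j)"
      by (auto simp: graph_def elim: computes_elims)
    define \<mu> where "\<mu> = (\<lambda>i. if i \<in> set J then ys ! (i - n) else \<nu> i)"
    have len: "length ys = length gs" using ys by (simp add: list_all2_lengthD)
    have J: "map \<mu> J = ys" using len by (auto simp: J_def \<mu>_def intro!: nth_equalityI)
    have I: "map \<mu> I = map \<nu> I" using disj by (auto simp: \<mu>_def)
    have "\<mu> (n + i) = ys ! i" if "i < length gs" for i using that by (simp add: \<mu>_def J_def)
    moreover have "\<mu> j = \<nu> j" using disj by (simp add: \<mu>_def)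
    ultimately have "\<mu> \<in> ?A"
      using ys by (simp add: graph_def list_all2_conv_all_nth I J len)
    moreover have "\<forall>i. i \<notin> set J \<longrightarrow> \<mu> i = \<nu> i" by (simp add: \<mu>_def)
    ultimately show "\<nu> \<in> {\<nu>. \<exists>\<mu> \<in> ?A. \<forall>i. i \<notin> set J \<longrightarrow> \<mu> i = \<nu> i}" by blast
  qed
  finally show ?thesis .
qed

section \<open>Primitive recursion\<close>

lemma computes_Prim_Suc_iff:
  "computes (Prim f g) (Suc n # xs) y
    \<longleftrightarrow> (\<exists>r. computes (Prim f g) (n # xs) r \<and> computes g (n # r # xs) y)"
  by (auto elim: computes_elims(6) intro: computes.prim_Suc)

lemma computes_Prim_0_iff: "computes (Prim f g) (0 # xs) y \<longleftrightarrow> computes f xs y"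
  by (auto elim: computes_elims(5) intro: computes.prim_0)

text \<open>One round of the recursion: join \<open>?B\<close> with the graph \<open>?G\<close> of
  the step function, whose value sits in the fresh \<open>y\<close>; project out the old value
  \<open>r\<close> to get \<open>?S\<close>; equate \<open>r\<close> with \<open>y\<close> and
  project out \<open>y\<close> to get \<open>?D\<close>; then increment \<open>i\<close> to return
  to \<open>?B\<close>.\<close>

lemma horn_def_graph_Prim_fresh:
  assumes f: "\<And>I j. horn_def (graph f I j)" and g: "\<And>I j. horn_def (graph g I j)"
    and ir: "i \<notin> set I" "r \<notin> set I" "i \<noteq> r"
  shows "horn_def (graph (Prim f g) (i # I) r)"
proof -
  obtain y where "\<forall>j \<in> set (i # r # I). j < y"
    using finite_nat_set_iff_bounded[of "set (i # r # I)"] by auto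
  then have y: "y \<noteq> i" "y \<noteq> r" "y \<notin> set I" by force+
  let ?B = "graph (Prim f g) (i # I) r" and ?G = "graph g (i # r # I) y"
  let ?S = "{\<nu>. computes (Prim f g) (Suc (\<nu> i) # map \<nu> I) (\<nu> y)}"
  let ?D = "{\<nu>. computes (Prim f g) (Suc (\<nu> i) # map \<nu> I) (\<nu> r)}"
  let ?E = "{\<nu> :: env. \<nu> r = \<nu> y}" and ?Z = "{\<nu>. \<nu> i = 0} \<inter> graph f I r"
  let ?T = "{And ?Z ?Z ?B, And ?B ?G (?B \<inter> ?G), And ?S ?E (?S \<inter> ?E), Up i ?D ?B}
    \<union> project_rules r (?B \<inter> ?G) ?S \<union> project_rules y (?S \<inter> ?E) ?D"
  show ?thesis
  proof (rule horn_def_by_rules[of "{?Z, ?G, ?E}" ?T])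
    fix \<rho> assume "\<rho> \<in> ?T"
    moreover have "sound \<rho>" if "\<rho> \<in> project_rules r (?B \<inter> ?G) ?S"
      by (rule project_rules_sound[OF _ _ that])
        (use ir y in \<open>auto simp: graph_def computes_Prim_Suc_iff\<close>)
    moreover have "sound \<rho>" if "\<rho> \<in> project_rules y (?S \<inter> ?E) ?D"
      by (rule project_rules_sound[OF _ _ that]) (use ir y in auto)
    ultimately show "sound \<rho>"
      using ir y by (auto simp: graph_def incr_def computes_Prim_0_iff closed.simps)
  next
    fix k L \<nu>
    assume d: "\<forall>\<rho> \<in> ?T. dims_below k \<rho>" and L: "\<forall>\<rho> \<in> ?T. closed L \<rho>"
      and H: "\<And>B \<nu>. B \<in> {?Z, ?G, ?E} \<Longrightarrow> supported k \<nu> \<Longrightarrow> \<nu> \<in> B \<Longrightarrow> (\<nu>, B) \<in> L"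
      and \<nu>: "supported k \<nu>" "\<nu> \<in> ?B"
    have k: "i < k" "r < k" "y < k"
      using d dims_below_project_rules[of r "?B \<inter> ?G" ?S k]
        dims_below_project_rules[of y "?S \<inter> ?E" ?D k] by auto
    have "supported k \<nu> \<Longrightarrow> \<nu> \<in> ?B \<Longrightarrow> \<nu> i = n \<Longrightarrow> (\<nu>, ?B) \<in> L" for n
    proof (induction n arbitrary: \<nu>)
      case 0
      then have "(\<nu>, ?Z) \<in> L" by (intro H) (auto simp: graph_def computes_Prim_0_iff)
      with L show ?case by (simp add: closed.simps)
    next
      case (Suc n)
      then obtain q where q: "computes (Prim f g) (n # map \<nu> I) q" "computes g (n # q # map \<nu> I) (\<nu> r)"
        by (auto simp: graph_def computes_Prim_Suc_iff)
      \<comment> \<open>The previous round with the new value already in \<open>y\<close>;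
        \<open>?\<mu>'\<close> also puts the old value \<open>q\<close> into
        \<open>r\<close>.\<close>
      let ?\<mu> = "\<nu>(i := n, y := \<nu> r)"
      let ?\<mu>' = "?\<mu>(r := q)"
      have s: "supported k ?\<mu>" "supported k ?\<mu>'" using Suc.prems k by (auto intro!: supported_upd)
      have "?\<mu>' \<in> ?B" using q ir y by (simp add: graph_def)
      then have "(?\<mu>', ?B) \<in> L" by (rule Suc.IH[OF s(2)]) (use ir y in simp)
      moreover have "(?\<mu>', ?G) \<in> L" using s q ir y by (intro H) (auto simp: graph_def)
      ultimately have "(?\<mu>', ?B \<inter> ?G) \<in> L" using L by (simp add: closed.simps)
      then have "(?\<mu>, ?S) \<in> L" by (rule project_rulesD[rotated]) (use L in blast)
      moreover have "(?\<mu>, ?E) \<in> L" using s ir y by (intro H) auto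
      ultimately have "(?\<mu>, ?S \<inter> ?E) \<in> L" using L by (simp add: closed.simps)
      then have "(\<nu>(i := n), ?D) \<in> L"
        by (rule project_rulesD[rotated]) (use L in blast)
      then have "(incr i (\<nu>(i := n)), ?B) \<in> L" using L by (simp add: closed.simps)
      moreover have "incr i (\<nu>(i := n)) = \<nu>" using Suc.prems by (simp add: incr_def fun_eq_iff)
      ultimately show ?case by simp
    qed
    with \<nu> show "(\<nu>, ?B) \<in> L" by simp
  qed (auto intro!: horn_def_Int horn_def_zero horn_def_eq f g)
qed

text \<open>The distinctness conditions disappear by recursing on fresh variables \<open>p\<close>
  and \<open>Suc p\<close>, tying them to \<open>i\<close> and \<open>j\<close> by equalities, and
  projecting them out.\<close>

lemma horn_def_graph_Prim:
  assumes f: "\<And>I j. horn_def (graph f I j)" and g: "\<And>I j. horn_def (graph g I j)"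
  shows "horn_def (graph (Prim f g) I j)"
proof (cases I)
  case Nil
  then have "graph (Prim f g) I j = {}" by (auto simp: graph_def elim: computes.cases)
  then show ?thesis by (simp add: horn_def_empty)
next
  case (Cons i I')
  obtain p where "\<forall>n \<in> set (j # i # I'). n < p"
    using finite_nat_set_iff_bounded[of "set (j # i # I')"] by auto
  then have p: "p \<noteq> i" "p \<noteq> j" "p \<notin> set I'" "Suc p \<noteq> i" "Suc p \<noteq> j" "Suc p \<notin> set I'"
    by force+
  let ?A = "graph (Prim f g) (p # I') (Suc p) \<inter> ({\<nu>. \<nu> p = \<nu> i} \<inter> {\<nu>. \<nu> (Suc p) = \<nu> j})"
  have "horn_def ?A"
    using p by (intro horn_def_Int horn_def_eq horn_def_graph_Prim_fresh f g) auto
  then have "horn_def {\<nu>. \<exists>n. \<nu>(Suc p := n) \<in> {\<nu>. \<exists>m. \<nu>(p := m) \<in> ?A}}"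
    by (intro horn_def_project)
  also have "{\<nu>. \<exists>n. \<nu>(Suc p := n) \<in> {\<nu>. \<exists>m. \<nu>(p := m) \<in> ?A}} = graph (Prim f g) I j"
    using p Cons by (auto simp: graph_def)
  finally show ?thesis .
qed

text \<open>Minimisation is a bounded universal quantifier with a zero test \<open>?N\<close>. The
  quantifier \<open>?S\<close> is derived by letting variable \<open>n\<close> grow as long as the
  value there is positive, that is, as long as \<open>?P\<close> holds.\<close>

lemma horn_def_graph_Mu:
  assumes f: "\<And>I j. horn_def (graph f I j)"
  shows "horn_def (graph (Mu f) I j)"
proof -
  obtain n where "\<forall>i \<in> set (j # I). i < n"
    using finite_nat_set_iff_bounded[of "set (j # I)"] by auto
  then have n: "n \<noteq> j" "n \<notin> set I" "Suc n \<noteq> j" "Suc n \<notin> set I" by force+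
  let ?P = "{\<nu>. \<exists>y. computes f (\<nu> n # map \<nu> I) (Suc y)}"
  let ?N = "{\<nu>. computes f (\<nu> n # map \<nu> I) 0}"
  let ?S = "{\<nu>. \<forall>m < \<nu> n. \<exists>y. computes f (m # map \<nu> I) (Suc y)}"
  let ?Z = "{\<nu> :: env. \<nu> n = 0}"
  have "horn_def {\<nu>. \<exists>m. \<nu>(Suc n := m) \<in> {\<nu>. incr (Suc n) \<nu> \<in> graph f (n # I) (Suc n)}}"
    by (intro horn_def_project horn_def_incr_vimage f)
  also have "{\<nu>. \<exists>m. \<nu>(Suc n := m) \<in> {\<nu>. incr (Suc n) \<nu> \<in> graph f (n # I) (Suc n)}} = ?P"
    using n by (auto simp: graph_def incr_def)
  finally have P: "horn_def ?P" .
  have "horn_def {\<nu>. \<exists>m. \<nu>(Suc n := m) \<in> graph f (n # I) (Suc n) \<inter> {\<nu>. \<nu> (Suc n) = 0}}"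
    by (intro horn_def_project horn_def_Int horn_def_zero f)
  also have "{\<nu>. \<exists>m. \<nu>(Suc n := m) \<in> graph f (n # I) (Suc n) \<inter> {\<nu>. \<nu> (Suc n) = 0}} = ?N"
    using n by (auto simp: graph_def)
  finally have N: "horn_def ?N" .
  have S: "horn_def ?S"
  proof (rule horn_def_by_rules[of "{?P, ?Z}" "{And ?Z ?Z ?S, And ?S ?P (?S \<inter> ?P), Up n (?S \<inter> ?P) ?S}"])
    fix k L \<nu>
    assume d: "\<forall>r \<in> {And ?Z ?Z ?S, And ?S ?P (?S \<inter> ?P), Up n (?S \<inter> ?P) ?S}. dims_below k r"
      and L: "\<forall>r \<in> {And ?Z ?Z ?S, And ?S ?P (?S \<inter> ?P), Up n (?S \<inter> ?P) ?S}. closed L r"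
      and H: "\<And>B \<nu>. B \<in> {?P, ?Z} \<Longrightarrow> supported k \<nu> \<Longrightarrow> \<nu> \<in> B \<Longrightarrow> (\<nu>, B) \<in> L"
      and \<nu>: "supported k \<nu>" "\<nu> \<in> ?S"
    have "supported k \<nu> \<Longrightarrow> \<nu> \<in> ?S \<Longrightarrow> \<nu> n = m \<Longrightarrow> (\<nu>, ?S) \<in> L" for m
    proof (induction m arbitrary: \<nu>)
      case 0
      then have "(\<nu>, ?Z) \<in> L" by (intro H) auto
      with L show ?case by (simp add: closed.simps)
    next
      case (Suc m)
      let ?\<mu> = "\<nu>(n := m)"
      have s: "supported k ?\<mu>" using Suc.prems d by (auto intro: supported_upd)
      have "?\<mu> \<in> ?S" using Suc.prems n by simp
      then have "(?\<mu>, ?S) \<in> L" by (rule Suc.IH[OF s]) simp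
      moreover have "(?\<mu>, ?P) \<in> L" using s Suc.prems n by (intro H) auto
      ultimately have "(incr n ?\<mu>, ?S) \<in> L" using L by (simp add: closed.simps)
      moreover have "incr n ?\<mu> = \<nu>" using Suc.prems by (simp add: incr_def fun_eq_iff)
      ultimately show ?case by simp
    qed
    with \<nu> show "(\<nu>, ?S) \<in> L" by simp
  qed (use n P in \<open>auto simp: incr_def less_Suc_eq closed.simps intro: horn_def_zero\<close>)
  have "horn_def {\<nu>. \<exists>m. \<nu>(n := m) \<in> ?S \<inter> (?N \<inter> {\<nu>. \<nu> n = \<nu> j})}"
    by (intro horn_def_project horn_def_Int S N horn_def_eq)
  also have "{\<nu>. \<exists>m. \<nu>(n := m) \<in> ?S \<inter> (?N \<inter> {\<nu>. \<nu> n = \<nu> j})} = graph (Mu f) I j"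
    using n by (auto simp: graph_def intro: computes.mu elim: computes_elims(7))
  finally show ?thesis .
qed

theorem horn_def_graph: "horn_def (graph f I j)"
proof (induction f arbitrary: I j)
  case Zero
  have "graph Zero I j = {\<nu>. \<nu> j = 0}"
    by (auto simp: graph_def elim: computes_elims(1) intro: computes.zero)
  then show ?case by (simp add: horn_def_zero)
next
  case Succ
  show ?case
  proof (cases "\<exists>i. I = [i] \<and> i \<noteq> j")
    case True
    then obtain i where "I = [i]" "i \<noteq> j" by blast
    then have "graph Succ I j = {\<nu>. \<nu> j = Suc (\<nu> i)}"
      by (auto simp: graph_def elim: computes_elims(2) intro: computes.succ)
    then show ?thesis using \<open>i \<noteq> j\<close> by (simp add: horn_def_Suc_eq)
  next
    case False
    then have "graph Succ I j = {}"
      by (auto simp: graph_def elim!: computes_elims(2))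
    then show ?thesis by (simp add: horn_def_empty)
  qed
next
  case (Proj i)
  show ?case
  proof (cases "i < length I")
    case True
    then have "graph (Proj i) I j = {\<nu>. \<nu> j = \<nu> (I ! i)}"
      using computes.proj[of i "map _ I"]
      by (auto simp: graph_def elim!: computes_elims(3))
    then show ?thesis by (simp add: horn_def_eq)
  next
    case False
    then have "graph (Proj i) I j = {}"
      by (auto simp: graph_def elim: computes_elims(3))
    then show ?thesis by (simp add: horn_def_empty)
  qed
qed (auto intro: horn_def_graph_Comp horn_def_graph_Prim horn_def_graph_Mu)

text \<open>Labels become numbers so that formulas can carry them as tags. Three are reserved:
  \<open>0\<close> for the axis of variable \<open>0\<close>, \<open>1\<close> for the origin,
  \<open>2\<close> for the target \<open>A\<close>. The first two let a formula locate the input on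
  the axis.\<close>

lemma horn_program:
  assumes "horn_def A"
  obtains k T Q where "0 < k" "finite T"
    "\<And>r. r \<in> T \<Longrightarrow> dims_below k r" "\<And>r. r \<in> T \<Longrightarrow> closed {(\<nu>, a :: nat). \<nu> \<in> Q a} r"
    "Q 0 = {\<nu>. \<forall>i > 0. \<nu> i = 0}" "Q 1 = {\<lambda>_. 0}" "Q 2 = A"
    "{Start 0, Start 1, Up 0 0 0} \<subseteq> T"
    "\<And>L \<nu>. \<forall>r \<in> T. closed L r \<Longrightarrow> supported k \<nu> \<Longrightarrow> \<nu> \<in> A \<Longrightarrow> (\<nu>, 2) \<in> L"
proof -
  have "\<forall>\<^sub>F k in sequentially. 0 < k
      \<and> (\<exists>T. finite T \<and> (\<forall>r \<in> T. dims_below k r \<and> sound r) \<and> forces k T A)"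
    using assms eventually_gt_at_top[of "0 :: nat"] by (auto simp: horn_def_def eventually_conj_iff)
  then obtain k T where k: "0 < k" and T: "finite T" "\<forall>r \<in> T. dims_below k r \<and> sound r" "forces k T A"
    by (auto simp: eventually_sequentially)
  define F where "F = insert A (\<Union>(set_rule ` T))"
  have "finite (set_rule r)" for r :: "env set rule" by (cases r) auto
  with T(1) have "countable F" by (auto simp: F_def countable_finite)
  \<comment> \<open>The shift by \<open>3\<close> keeps the labels of \<open>T\<close> clear of the
    reserved ones.\<close>
  define f where "f B = to_nat_on F B + 3" for B
  define Q where "Q j = (if j = 0 then {\<nu>. \<forall>i > 0. \<nu> i = 0} else if j = 1 then {\<lambda>_. 0}
      else if j = 2 then A else from_nat_into F (j - 3))" for j :: nat
  have Q: "Q 0 = {\<nu>. \<forall>i > 0. \<nu> i = 0}" "Q 1 = {\<lambda>_. 0}" "Q 2 = A" by (simp_all add: Q_def)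
  have Qf: "Q (f B) = B" if "B \<in> F" for B
    using that \<open>countable F\<close> by (simp add: Q_def f_def)
  \<comment> \<open>\<open>A\<close> is derived under its label \<open>f A\<close> and then copied
    to \<open>2\<close>.\<close>
  define T' where "T' = map_rule f ` T \<union> {Start 0, Start 1, Up 0 0 0, And (f A) (f A) 2}"
  show thesis
  proof
    show "0 < k" "finite T'" using k T by (auto simp: T'_def)
    show "{Start 0, Start 1, Up 0 0 0} \<subseteq> T'" by (simp add: T'_def)
    show "dims_below k r" if "r \<in> T'" for r
      using that k T by (auto simp: T'_def)
    show "closed {(\<nu>, a). \<nu> \<in> Q a} r" if "r \<in> T'" for r
    proof -
      have "closed {(\<nu>, a). \<nu> \<in> Q a} (map_rule f r)" if "r \<in> T" for r
      proof -
        have "closed {(\<nu>, B). \<nu> \<in> Q (f B)} r \<longleftrightarrow> sound r"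
          by (rule closed_cong) (use that Qf in \<open>auto simp: F_def\<close>)
        with T that show ?thesis by (simp add: closed_map_rule)
      qed
      moreover have "closed {(\<nu>, a). \<nu> \<in> Q a} (And (f A) (f A) 2)"
        using Qf[of A] by (simp add: closed.simps F_def Q)
      moreover have "closed {(\<nu>, a). \<nu> \<in> Q a} (Up 0 0 0)" "closed {(\<nu>, a). \<nu> \<in> Q a} (Start 0)"
        "closed {(\<nu>, a). \<nu> \<in> Q a} (Start 1)"
        unfolding closed.simps by (simp_all add: Q incr_def del: One_nat_def)
      ultimately show ?thesis using that unfolding T'_def by blast
    qed
    show "(\<nu>, 2) \<in> L" if L: "\<forall>r \<in> T'. closed L r" and \<nu>: "supported k \<nu>" "\<nu> \<in> A" for L \<nu>
    proof -
      have "\<forall>r \<in> T. closed {(\<nu>, B). (\<nu>, f B) \<in> L} r"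
        using L by (auto simp: T'_def closed_map_rule)
      with T(3) \<nu> have "(\<nu>, f A) \<in> L" by (auto simp: forces_def)
      moreover have "closed L (And (f A) (f A) 2)" using L by (simp add: T'_def)
      ultimately show ?thesis by (auto dest: closed_AndD)
    qed
  qed (rule Q)+
qed


section \<open>The formulas of the reduction\<close>

definition Top :: fm where "Top = Neg (Conj Known (Neg Known))"
definition Imp :: "fm \<Rightarrow> fm \<Rightarrow> fm" where "Imp \<phi> \<psi> = Neg (Conj \<phi> (Neg \<psi>))"
definition Box :: "fm \<Rightarrow> fm" where "Box \<phi> = Neg (Dia (Neg \<phi>))"
definition Conjs :: "fm list \<Rightarrow> fm" where "Conjs \<phi>s = foldr Conj \<phi>s Top"

lemma holds_Top [simp]: "holds M S w Top"
  by (simp add: Top_def)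

lemma holds_Imp [simp]: "holds M S w (Imp \<phi> \<psi>) \<longleftrightarrow> (holds M S w \<phi> \<longrightarrow> holds M S w \<psi>)"
  by (simp add: Imp_def)

lemma holds_Box [simp]:
  "holds M S w (Box \<phi>) \<longleftrightarrow> (\<forall>t \<in> fst M. (w, t) \<in> snd M \<longrightarrow> holds M (insert w S) t \<phi>)"
  by (auto simp: Box_def)

lemma holds_Conjs [simp]: "holds M S w (Conjs \<phi>s) \<longleftrightarrow> (\<forall>\<phi> \<in> set \<phi>s. holds M S w \<phi>)"
  by (induction \<phi>s) (auto simp: Conjs_def)

text \<open>
  A proposition is simulated by an edge to a dead-end chain of a given length. The additional
  edge to a point without successors keeps the points of the chains themselves from being tagged.
\<close>

primrec chain :: "nat \<Rightarrow> fm" where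
  "chain 0 = Neg (Dia Top)"
| "chain (Suc n) = Conj (Dia (chain n)) (Box (chain n))"

definition tag :: "nat \<Rightarrow> fm" where
  "tag j = Conj (Dia (chain 0)) (Dia (chain (Suc j)))"

definition tagged :: "'a frame \<Rightarrow> 'a \<Rightarrow> nat \<Rightarrow> bool" where
  "tagged M x j \<longleftrightarrow> holds M {} x (tag j)"

text \<open>\<open>Known\<close> occurs in chains only inside the valid formula \<open>Top\<close>,
  so the memory has no influence. Hence tags keep their truth value throughout an
  evaluation.\<close>

lemma holds_chain_indep: "holds M S x (chain n) \<longleftrightarrow> holds M S' x (chain n)"
proof (induction n arbitrary: S S' x)
  case (Suc n)
  then show ?case unfolding chain.simps holds.simps holds_Box by metis
qed simp

lemma holds_tag [simp]: "holds M S x (tag j) \<longleftrightarrow> tagged M x j"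
proof -
  have "holds M S x (Dia (chain n)) \<longleftrightarrow> holds M {} x (Dia (chain n))" for n
    using holds_chain_indep unfolding holds.simps by metis
  then show ?thesis
    unfolding tagged_def tag_def holds.simps(2) by (intro arg_cong2[where f = "(\<and>)"])
qed

text \<open>
  Even tags are labels of Horn rules, odd tags are colours. The grid points use the colours
  below \<open>2 * k + 1\<close>, and the colour \<open>2 * k + 1\<close> is that of the root.
\<close>

abbreviation "label j \<equiv> tag (2 * j)"

definition colour :: "nat \<Rightarrow> nat \<Rightarrow> fm" where
  "colour k c = Conjs (tag (2 * c + 1)
     # map (\<lambda>d. Neg (tag (2 * d + 1))) (filter (\<lambda>d. d \<noteq> c) [0..<2 * k + 2]))"

definition coloured :: "nat \<Rightarrow> 'a frame \<Rightarrow> 'a \<Rightarrow> nat \<Rightarrow> bool" where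
  "coloured k M x c \<longleftrightarrow> tagged M x (2 * c + 1) \<and> (\<forall>d < 2 * k + 2. d \<noteq> c \<longrightarrow> \<not> tagged M x (2 * d + 1))"

lemma holds_colour [simp]: "holds M S x (colour k c) \<longleftrightarrow> coloured k M x c"
  by (auto simp: colour_def coloured_def simp del: upt_Suc)

lemma coloured_unique:
  "coloured k M x c \<Longrightarrow> coloured k M x d \<Longrightarrow> c < 2 * k + 2 \<Longrightarrow> c = d"
  by (auto simp: coloured_def)

text \<open>
  Direction \<open>i < k\<close> of the grid adds \<open>i + 1\<close> to the colour. Modulo \<open>2 * k + 1\<close> the colour
  determines the direction of an edge, and neither one nor two steps restore the colour.
\<close>

definition nxt :: "nat \<Rightarrow> nat \<Rightarrow> nat \<Rightarrow> nat" where
  "nxt k i c = (c + Suc i) mod (2 * k + 1)"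

lemma nxt_less [simp]: "nxt k i c < 2 * k + 1"
  by (simp add: nxt_def)

lemma nxt_neq: "i < k \<Longrightarrow> c < 2 * k + 1 \<Longrightarrow> nxt k i c \<noteq> c"
  by (auto simp: nxt_def mod_if)

lemma nxt_commute: "nxt k i (nxt k j c) = nxt k j (nxt k i c)"
  unfolding nxt_def mod_add_left_eq by (simp only: add_ac)

lemma nxt_nxt_neq: "i < k \<Longrightarrow> j < k \<Longrightarrow> c < 2 * k + 1 \<Longrightarrow> nxt k i (nxt k j c) \<noteq> c"
  by (auto simp: nxt_def mod_if)

lemma nxt_inj: "i < k \<Longrightarrow> j < k \<Longrightarrow> c < 2 * k + 1 \<Longrightarrow> nxt k i c = nxt k j c \<longleftrightarrow> i = j"
  by (auto simp: nxt_def mod_if split: if_splits)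

section \<open>Formulas for the grid, the rules and the input\<close>

definition Back :: "nat \<Rightarrow> fm \<Rightarrow> fm" where
  "Back k \<phi> = Dia (Conj (Conj (colour k (2 * k + 1)) Known) \<phi>)"

text \<open>
  Holds at a grid point of colour \<open>c\<close> when only the root is remembered. After a step in
  direction \<open>i\<close>, and possibly one in direction \<open>j\<close>, the evaluation jumps back to the root, and
  from there to the starting point, which is the only remembered point of its colour.
\<close>

definition grid :: "nat \<Rightarrow> nat \<Rightarrow> nat \<Rightarrow> nat \<Rightarrow> fm" where
  "grid k i j c = Conjs
    [Dia (colour k (nxt k i c)),
     Box (Imp (colour k (nxt k i c)) (Back k (Conj
       (Dia (Conj Known (colour k (nxt k i c))))
       (Dia (Conj (Conj Known (colour k c)) (Box (Imp (colour k (nxt k i c)) Known))))))),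
     Box (Imp (colour k (nxt k i c)) (Box (Imp (colour k (nxt k j (nxt k i c))) (Back k
       (Dia (Conj (Conj Known (colour k c)) (Dia (Conj (colour k (nxt k j c))
         (Dia (Conj Known (colour k (nxt k j (nxt k i c)))))))))))))]"

text \<open>The parameter \<open>c\<close> is the colour of the current point, so that a successor
  of colour \<open>nxt k i c\<close> is recognised as the one in direction \<open>i\<close>.
  \<open>Start\<close> rules concern the origin only and are left to
  \<open>start_fm\<close>.\<close>

fun rule_fm :: "nat \<Rightarrow> nat \<Rightarrow> nat rule \<Rightarrow> fm" where
  "rule_fm k c (And a b d) = Imp (Conj (label a) (label b)) (label d)"
| "rule_fm k c (Up i a b) = Imp (label a) (Box (Imp (colour k (nxt k i c)) (label b)))"
| "rule_fm k c (Down i a b) = Imp (Dia (Conj (colour k (nxt k i c)) (label a))) (label b)"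
| "rule_fm k c (Start a) = Top"

fun start_fm :: "nat rule \<Rightarrow> fm" where
  "start_fm (Start a) = label a"
| "start_fm _ = Top"

text \<open>To be evaluated at the root with empty memory: inside the \<open>Box\<close> only the
  root is then remembered, as \<open>grid\<close> expects.\<close>

definition program_fm :: "nat \<Rightarrow> nat rule list \<Rightarrow> fm" where
  "program_fm k rs = Conjs
    [colour k (2 * k + 1),
     Dia (Conj (colour k 0) (Conjs (map start_fm rs))),
     Box (Conjs [Imp (colour k c) (Conj
       (Conjs [grid k i j c. i \<leftarrow> [0..<k], j \<leftarrow> [0..<k]]) (Conjs (map (rule_fm k c) rs))).
       c \<leftarrow> [0..<2 * k + 1]])]"

text \<open>In the intended model label \<open>0\<close> confines the walk to the first axis; in
  other models the walk along the axis is one possible choice, which suffices.\<close>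

primrec walk :: "nat \<Rightarrow> fm" where
  "walk 0 = label 2"
| "walk (Suc n) = Dia (Conj (label 0) (walk n))"

definition input_fm :: "nat \<Rightarrow> fm" where
  "input_fm n = Neg (Dia (Conj (label 1) (walk n)))"


section \<open>Models of the program formula are closed under its rules\<close>

text \<open>\<open>E \<nu>\<close> applies every \<open>f i\<close> with \<open>i < k\<close>
  exactly \<open>\<nu> i\<close> times to \<open>z\<close>, in a fixed order; by commutation one
  more application can be moved to its place.\<close>

lemma commuting_family:
  fixes f :: "nat \<Rightarrow> 'a \<Rightarrow> 'a"
  assumes P: "P z" "\<And>i x. i < k \<Longrightarrow> P x \<Longrightarrow> P (f i x)"
    and comm: "\<And>i j x. i < k \<Longrightarrow> j < k \<Longrightarrow> P x \<Longrightarrow> f i (f j x) = f j (f i x)"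
  obtains E where "E (\<lambda>_. 0) = z" "\<And>\<nu>. P (E \<nu>)" "\<And>i \<nu>. i < k \<Longrightarrow> E (incr i \<nu>) = f i (E \<nu>)"
proof -
  define E where "E m \<nu> = fold (\<lambda>i. f i ^^ \<nu> i) [0..<m] z" for m and \<nu> :: env
  have pow: "P ((f i ^^ n) x)" if "i < k" "P x" for i n x
    using that P(2) by (induction n) auto
  have pow_comm: "f j ((f i ^^ n) x) = (f i ^^ n) (f j x)" if "i < k" "j < k" "P x" for i j n x
    using that comm pow by (induction n) auto
  have PE: "P (E m \<nu>)" if "m \<le> k" for m \<nu>
    using that P(1) pow by (induction m) (auto simp: E_def)
  have incr: "E m (incr i \<nu>) = (if i < m then f i (E m \<nu>) else E m \<nu>)" if "m \<le> k" "i < k" for m i \<nu>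
    using that
  proof (induction m)
    case (Suc m)
    have *: "E (Suc m) \<mu> = (f m ^^ \<mu> m) (E m \<mu>)" for \<mu> by (simp add: E_def)
    show ?case
    proof (cases "i = m")
      case True
      then show ?thesis using Suc by (simp add: * incr_def)
    next
      case False
      then have "(incr i \<nu>) m = \<nu> m" by (simp add: incr_def)
      then show ?thesis using Suc False pow_comm[of m i "E m \<nu>"] PE by (simp add: *)
    qed
  qed (simp add: E_def)
  show thesis
  proof (rule that[of "E k"])
    have "fold (\<lambda>i. f i ^^ 0) [0..<m] z = z" for m by (induction m) auto
    then show "E k (\<lambda>_. 0) = z" by (simp add: E_def)
  qed (use PE incr in auto)
qed

text \<open>The memory serves as a set of names. The points \<open>s\<close>, \<open>e\<close>,
  \<open>t\<close>, \<open>u\<close> have distinct colours, so a jump to a remembered point of given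
  colour has only one possible target among them. Returning to \<open>e\<close> with
  \<open>t\<close> remembered lets \<open>Known\<close> express identity with \<open>t\<close>,
  giving uniqueness; returning with \<open>u\<close> remembered closes the square.\<close>

lemma grid_sound:
  assumes M: "holds (W, R) {s} e (grid k i j c)"
    and s: "coloured k (W, R) s (2 * k + 1)" and e: "coloured k (W, R) e c" "c < 2 * k + 1"
    and k: "i < k" "j < k" and R: "R \<subseteq> W \<times> W"
  shows "\<exists>t. (e, t) \<in> R \<and> coloured k (W, R) t (nxt k i c)"
    and "(e, t) \<in> R \<Longrightarrow> coloured k (W, R) t (nxt k i c) \<Longrightarrow> (s, t) \<in> R"
    and "(e, t) \<in> R \<Longrightarrow> coloured k (W, R) t (nxt k i c) \<Longrightarrow>
      (e, t') \<in> R \<Longrightarrow> coloured k (W, R) t' (nxt k i c) \<Longrightarrow> t' = t"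
    and "(e, t) \<in> R \<Longrightarrow> coloured k (W, R) t (nxt k i c) \<Longrightarrow>
      (t, u) \<in> R \<Longrightarrow> coloured k (W, R) u (nxt k j (nxt k i c)) \<Longrightarrow>
      \<exists>v. (e, v) \<in> R \<and> coloured k (W, R) v (nxt k j c) \<and> (v, u) \<in> R"
proof -
  let ?C = "coloured k (W, R)"
  have W: "x \<in> W \<and> y \<in> W" if "(x, y) \<in> R" for x y using that R by auto
  \<comment> \<open>A point has at most one colour in this range, so \<open>col\<close> reduces
    distinctness of points to distinctness of colours.\<close>
  define col where "col x = (SOME c. ?C x c \<and> c < 2 * k + 2)" for x
  have col: "col x = c" if "?C x c" "c < 2 * k + 2" for x c
    unfolding col_def using that coloured_unique[of k "(W, R)" x] by (intro some_equality) auto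
  have nxt: "nxt k i c < 2 * k + 1" "nxt k i c < 2 * k + 2" for i c
    using nxt_less[of k i c] by linarith+
  have [simp]: "col s = 2 * k + 1" "col e = c" using col s e by simp_all
  have neq: "nxt k i c \<noteq> c" "nxt k j c \<noteq> c" "nxt k j (nxt k i c) \<noteq> c"
    "nxt k j (nxt k i c) \<noteq> nxt k i c" "nxt k j (nxt k i c) \<noteq> nxt k j c"
    using nxt_neq[OF _ e(2)] nxt_nxt_neq[OF _ _ e(2)] nxt_neq[OF _ nxt(1)] k nxt_commute[of k j i]
    by metis+
  show "\<exists>t. (e, t) \<in> R \<and> ?C t (nxt k i c)"
    using M by (auto simp: grid_def)
  {
    assume t: "(e, t) \<in> R" "?C t (nxt k i c)"
    have [simp]: "col t = nxt k i c" using col t nxt by blast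
    have "holds (W, R) {e, s} t (Back k (Conj
       (Dia (Conj Known (colour k (nxt k i c))))
       (Dia (Conj (Conj Known (colour k c)) (Box (Imp (colour k (nxt k i c)) Known))))))"
      using M t W[OF t(1)] by (simp add: grid_def)
    moreover define S where "S = {s, e, t}"
    then have "{e, s} \<union> {t} = S" by auto
    ultimately obtain x where x: "x \<in> S" "?C x (2 * k + 1)"
      and x1: "holds (W, R) S x (Dia (Conj Known (colour k (nxt k i c))))"
      and x2: "holds (W, R) S x
        (Dia (Conj (Conj Known (colour k c)) (Box (Imp (colour k (nxt k i c)) Known))))"
      unfolding Back_def holds.simps(2-4) holds_colour by metis
    have "x = s" using x(1) col[OF x(2)] nxt(1)[of i c] e(2) by (auto simp: S_def)
    have Ss: "S \<union> {s} = S" by (auto simp: S_def)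
    from x1 obtain y where y: "(s, y) \<in> R" "y \<in> S" "?C y (nxt k i c)"
      unfolding holds.simps holds_colour fst_conv snd_conv \<open>x = s\<close> Ss by blast
    have "y = t" using y(2) col[OF y(3) nxt(2)] nxt(1)[of i c] neq by (auto simp: S_def)
    with y show "(s, t) \<in> R" by simp
    from x2 obtain z where z: "z \<in> S" "?C z c"
      and z1: "holds (W, R) S z (Box (Imp (colour k (nxt k i c)) Known))"
      unfolding holds.simps holds_colour fst_conv snd_conv \<open>x = s\<close> Ss by blast
    have "col z = c" using col[OF z(2)] e(2) by simp
    moreover have "z = s \<or> z = e \<or> z = t" using z(1) by (simp add: S_def)
    ultimately have "z = e" using e(2) neq(1) by (elim disjE) simp_all
    show "t' = t" if t': "(e, t') \<in> R" "?C t' (nxt k i c)"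
    proof -
      \<comment> \<open>Back at \<open>e\<close>, every successor of this colour must be known
        already, and only \<open>t\<close> among the known points has it.\<close>
      have "t' \<in> S" using z1 t' W[OF t'(1)] z(1) \<open>z = e\<close> by auto
      then show ?thesis using col[OF t'(2) nxt(2)] nxt(1)[of i c] neq by (auto simp: S_def)
    qed
  }
  assume t: "(e, t) \<in> R" "?C t (nxt k i c)" and u: "(t, u) \<in> R" "?C u (nxt k j (nxt k i c))"
  have [simp]: "col t = nxt k i c" "col u = nxt k j (nxt k i c)" using col t u nxt by blast+
  have "holds (W, R) {t, e, s} u (Back k
       (Dia (Conj (Conj Known (colour k c)) (Dia (Conj (colour k (nxt k j c))
         (Dia (Conj Known (colour k (nxt k j (nxt k i c))))))))))"
    using M t u W[OF t(1)] W[OF u(1)] by (simp add: grid_def)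
  moreover define S where "S = {s, e, t, u}"
  then have "{t, e, s} \<union> {u} = S" by auto
  ultimately obtain x where x: "x \<in> S" "?C x (2 * k + 1)"
    and x1: "holds (W, R) S x (Dia (Conj (Conj Known (colour k c))
      (Dia (Conj (colour k (nxt k j c)) (Dia (Conj Known (colour k (nxt k j (nxt k i c)))))))))"
    unfolding Back_def holds.simps(2-4) holds_colour by metis
  have "x = s"
    using x(1) col[OF x(2)] nxt(1)[of i c] nxt(1)[of j "nxt k i c"] e(2) by (auto simp: S_def)
  have Ss: "S \<union> {s} = S" by (auto simp: S_def)
  from x1 obtain y where y: "y \<in> S" "?C y c" and y1: "holds (W, R) S y
      (Dia (Conj (colour k (nxt k j c)) (Dia (Conj Known (colour k (nxt k j (nxt k i c)))))))"
    unfolding holds.simps holds_colour fst_conv snd_conv \<open>x = s\<close> Ss by blast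
  have "col y = c" using col[OF y(2)] e(2) by simp
  moreover have "y = s \<or> y = e \<or> y = t \<or> y = u" using y(1) by (simp add: S_def)
  ultimately have "y = e" using e(2) neq(1,3) by (elim disjE) simp_all
  have Se: "S \<union> {e} = S" by (auto simp: S_def)
  from y1 obtain v w where v: "(e, v) \<in> R" "?C v (nxt k j c)"
    and w: "(v, w) \<in> R" "?C w (nxt k j (nxt k i c))" "w \<in> S \<union> {v}"
    unfolding holds.simps holds_colour fst_conv snd_conv \<open>y = e\<close> Se by blast
  \<comment> \<open>\<open>v\<close> has joined the memory, but its colour rules it out as
    \<open>w\<close>.\<close>
  have "col v = nxt k j c" using col v(2) nxt by blast
  then have "w = u"
    using w(3) col[OF w(2) nxt(2)] nxt(1)[of j "nxt k i c"] neq by (auto simp: S_def)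
  with v w show "\<exists>v. (e, v) \<in> R \<and> ?C v (nxt k j c) \<and> (v, u) \<in> R"
    by blast
qed

text \<open>By \<open>grid_sound\<close> the directions act as commuting functions, so all
  environments map into the model, and the rule formulas at their images close the labels found
  there. The map need not be injective, since only the presence of forced labels matters.\<close>

lemma program_sound:
  assumes W: "R \<subseteq> W \<times> W" and M: "holds (W, R) {} s (program_fm k rs)"
    and k: "0 < k" "\<And>r. r \<in> set rs \<Longrightarrow> dims_below k r"
  obtains E where "\<And>\<nu>. (s, E \<nu>) \<in> R" "\<And>i \<nu>. i < k \<Longrightarrow> (E \<nu>, E (incr i \<nu>)) \<in> R"
    "\<And>r. r \<in> set rs \<Longrightarrow> closed {(\<nu>, a). tagged (W, R) (E \<nu>) (2 * a)} r"
proof -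
  let ?C = "coloured k (W, R)"
  have s: "?C s (2 * k + 1)" using M by (simp add: program_fm_def)
  have inW: "x \<in> W \<and> y \<in> W" if "(x, y) \<in> R" for x y using that W by auto
  from M obtain z where z: "(s, z) \<in> R" "?C z 0"
    and start: "\<And>a. Start a \<in> set rs \<Longrightarrow> tagged (W, R) z (2 * a)"
    by (force simp: program_fm_def)
  define good where "good e c \<longleftrightarrow> (s, e) \<in> R \<and> c < 2 * k + 1 \<and> ?C e c" for e c
  define F where "F c = Conj (Conjs [grid k i j c. i \<leftarrow> [0..<k], j \<leftarrow> [0..<k]])
    (Conjs (map (rule_fm k c) rs))" for c
  have loc: "holds (W, R) {s} e (F c)" if "good e c" for e c
  proof -
    have "holds (W, R) {} s (Box (Conjs [Imp (colour k c) (F c). c \<leftarrow> [0..<2 * k + 1]]))"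
      using M unfolding program_fm_def holds_Conjs F_def by simp
    moreover have "e \<in> W" "(s, e) \<in> R" using that inW by (auto simp: good_def)
    ultimately have "holds (W, R) {s} e (Conjs [Imp (colour k c) (F c). c \<leftarrow> [0..<2 * k + 1]])"
      by simp
    then have "\<forall>c < 2 * k + 1. holds (W, R) {s} e (Imp (colour k c) (F c))"
      unfolding holds_Conjs set_map set_upt by auto
    then show ?thesis using that unfolding holds_Imp holds_colour good_def by blast
  qed
  have grid: "holds (W, R) {s} e (grid k i j c)" if "good e c" "i < k" "j < k" for e c i j
    using loc[OF that(1)] that(2,3) unfolding F_def holds.simps holds_Conjs by auto
  have rule: "holds (W, R) {s} e (rule_fm k c r)" if "good e c" "r \<in> set rs" for e c r
    using loc[OF that(1)] that(2) unfolding F_def holds.simps holds_Conjs by auto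
  note gs = grid_sound[OF grid s _ _ _ _ W]
  \<comment> \<open>The colour is bound inside the choice, so that \<open>step i\<close> is a
    function of the point alone, as \<open>commuting_family\<close> requires.\<close>
  define step where "step i e = (SOME t. \<exists>c. good e c \<and> (e, t) \<in> R \<and> ?C t (nxt k i c))" for i e
  have good_unique: "c = d" if "good e c" "good e d" for e c d
    using that by (auto simp: good_def intro: coloured_unique)
  have step: "(e, step i e) \<in> R \<and> ?C (step i e) (nxt k i c)" if e: "good e c" and i: "i < k" for e c i
  proof -
    have "\<exists>t. (e, t) \<in> R \<and> ?C t (nxt k i c)"
      using gs(1)[OF e i i] e i by (simp add: good_def)
    then have "\<exists>t c. good e c \<and> (e, t) \<in> R \<and> ?C t (nxt k i c)" using e by blast
    from someI_ex[OF this] show ?thesis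
      unfolding step_def using good_unique[OF e] by blast
  qed
  have step_good: "good (step i e) (nxt k i c)" if "good e c" "i < k" for e c i
    using step[OF that] gs(2)[OF that(1,2,2)] that nxt_less[of k i c]
    unfolding good_def by (metis (full_types))
  have step_eq: "t = step i e" if "good e c" "i < k" "(e, t) \<in> R" "?C t (nxt k i c)" for e c i t
    using step[OF that(1,2)] gs(3)[OF that(1,2,2)] that unfolding good_def by metis
  have comm: "step i (step j e) = step j (step i e)" if e: "good e c" and ij: "i < k" "j < k" for e c i j
  proof -
    let ?t = "step i e" and ?u = "step j (step i e)"
    have "(e, ?t) \<in> R" "?C ?t (nxt k i c)" "(?t, ?u) \<in> R" "?C ?u (nxt k j (nxt k i c))"
      using step[OF e ij(1)] step[OF step_good[OF e ij(1)] ij(2)] by auto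
    then obtain v where v: "(e, v) \<in> R" "?C v (nxt k j c)" "(v, ?u) \<in> R"
      using gs(4)[OF e ij] e ij by (metis good_def)
    have "v = step j e" using step_eq[OF e ij(2) v(1,2)] .
    moreover have "?u = step i v"
      using step_eq[OF step_good[OF e ij(2)] ij(1)] v(3) \<open>?C ?u _\<close> \<open>v = step j e\<close>
      by (metis nxt_commute)
    ultimately show ?thesis by simp
  qed
  obtain E where E: "E (\<lambda>_. 0) = z" "\<And>\<nu>. \<exists>c. good (E \<nu>) c"
    "\<And>i \<nu>. i < k \<Longrightarrow> E (incr i \<nu>) = step i (E \<nu>)"
  proof (rule commuting_family[of "\<lambda>e. \<exists>c. good e c" z k step])
    show "\<exists>c. good z c" using z by (auto simp: good_def)
  qed (use step_good comm in blast)+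
  show thesis
  proof
    show "(s, E \<nu>) \<in> R" for \<nu> using E(2) by (auto simp: good_def)
    show "(E \<nu>, E (incr i \<nu>)) \<in> R" if "i < k" for i \<nu> using E that step by metis
    show "closed {(\<nu>, a). tagged (W, R) (E \<nu>) (2 * a)} r" if r: "r \<in> set rs" for r
    proof -
      have rule': "\<exists>c. holds (W, R) {s} (E \<nu>) (rule_fm k c r)
          \<and> (\<forall>i < k. E (incr i \<nu>) \<in> W \<and> (E \<nu>, E (incr i \<nu>)) \<in> R \<and> ?C (E (incr i \<nu>)) (nxt k i c))" for \<nu>
        using E(2)[of \<nu>] rule[OF _ r] step E(3) inW by metis
      show ?thesis
      proof (cases r)
        case (And a b d)
        then show ?thesis using rule' by (simp add: closed.simps)
      next
        case (Up i a b)
        then have "i < k" using k(2)[OF r] by simp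
        then show ?thesis using rule' Up by (simp add: closed.simps) metis
      next
        case (Down i a b)
        then have "i < k" using k(2)[OF r] by simp
        then show ?thesis using rule' Down by (simp add: closed.simps) metis
      next
        case (Start a)
        then show ?thesis using start[of a] r E(1) by (simp add: closed.simps)
      qed
    qed
  qed
qed

section \<open>Walks along the first axis\<close>

definition axis_env :: "nat \<Rightarrow> env" where
  "axis_env n = (\<lambda>_. 0)(0 := n)"

lemma axis_env_simps [simp]: "axis_env n 0 = n" "i \<noteq> 0 \<Longrightarrow> axis_env n i = 0"
  by (simp_all add: axis_env_def)

lemma axis_env_0: "axis_env 0 = (\<lambda>_. 0)"
  by (auto simp: axis_env_def)

lemma incr_axis_env: "incr 0 (axis_env n) = axis_env (Suc n)"
  by (auto simp: axis_env_def incr_def)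

text \<open>Tags do not depend on the memory, so the points visited on the way do no harm. Tags
  \<open>0\<close> and \<open>4\<close> are the labels \<open>0\<close> and
  \<open>2\<close>.\<close>

lemma holds_walkI:
  assumes "\<And>\<nu>. (E \<nu>, E (incr 0 \<nu>)) \<in> R" "R \<subseteq> W \<times> W"
    and "\<And>m. tagged (W, R) (E (axis_env m)) 0" "tagged (W, R) (E (axis_env (m + n))) 4"
  shows "holds (W, R) S (E (axis_env m)) (walk n)"
  using assms(4)
proof (induction n arbitrary: m S)
  case (Suc n)
  let ?x = "E (axis_env m)" and ?y = "E (axis_env (Suc m))"
  have "(?x, ?y) \<in> R" using assms(1)[of "axis_env m"] by (simp only: incr_axis_env)
  moreover have "holds (W, R) (S \<union> {?x}) ?y (walk n)" using Suc by (intro Suc.IH) simp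
  moreover have "tagged (W, R) ?y 0" by (rule assms(3))
  ultimately show ?case
    using assms(2) unfolding walk.simps holds.simps(2,3) holds_tag mult_0_right fst_conv snd_conv by blast
qed simp


section \<open>The intended model\<close>

text \<open>The gadgets form a single descending chain shared by all tagged points;
  \<open>Gadget n\<close> is the point that satisfies \<open>chain n\<close>.\<close>

datatype node = Root | Env env | Gadget nat

text \<open>The weight \<open>Suc i\<close> makes a step in direction \<open>i\<close> act on
  colours as \<open>nxt k i\<close>.\<close>

definition env_colour :: "nat \<Rightarrow> env \<Rightarrow> nat" where
  "env_colour k \<nu> = (\<Sum>i<k. Suc i * \<nu> i) mod (2 * k + 1)"

lemma env_colour_incr: "i < k \<Longrightarrow> env_colour k (incr i \<nu>) = nxt k i (env_colour k \<nu>)"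
proof -
  assume i: "i < k"
  have "(\<Sum>j<k. Suc j * incr i \<nu> j) = (\<Sum>j<k. Suc j * \<nu> j + (if j = i then Suc i else 0))"
    by (intro sum.cong) (auto simp: incr_def)
  also have "\<dots> = (\<Sum>j<k. Suc j * \<nu> j) + Suc i"
    using i by (simp only: sum.distrib sum.delta) simp
  finally show ?thesis by (simp only: env_colour_def nxt_def mod_add_left_eq)
qed

lemma env_colour_less [simp]: "env_colour k \<nu> < 2 * k + 1"
  by (simp add: env_colour_def)

fun tags :: "nat \<Rightarrow> (nat \<Rightarrow> env set) \<Rightarrow> node \<Rightarrow> nat set" where
  "tags k Q Root = {2 * (2 * k + 1) + 1}"
| "tags k Q (Env \<nu>) = insert (2 * env_colour k \<nu> + 1) {2 * j |j. \<nu> \<in> Q j}"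
| "tags k Q (Gadget n) = {}"

text \<open>\<open>Root\<close> and all \<open>Env\<close> points see \<open>Gadget 0\<close>, as
  the first conjunct of \<open>tag\<close> demands; an edge to \<open>Gadget (Suc j)\<close> then
  realises tag \<open>j\<close>.\<close>

fun edge :: "nat \<Rightarrow> (nat \<Rightarrow> env set) \<Rightarrow> node \<Rightarrow> node \<Rightarrow> bool" where
  "edge k Q (Gadget n) y \<longleftrightarrow> (\<exists>m. n = Suc m \<and> y = Gadget m)"
| "edge k Q x (Gadget n) \<longleftrightarrow> n = 0 \<or> n - 1 \<in> tags k Q x"
| "edge k Q Root y \<longleftrightarrow> (\<exists>\<nu>. y = Env \<nu>)"
| "edge k Q (Env \<nu>) y \<longleftrightarrow> y = Root \<or> (\<exists>i < k. y = Env (incr i \<nu>))"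

definition grid_frame :: "nat \<Rightarrow> (nat \<Rightarrow> env set) \<Rightarrow> node frame" where
  "grid_frame k Q = (UNIV, {(x, y). edge k Q x y})"

lemma grid_frame_simps [simp]:
  "fst (grid_frame k Q) = UNIV" "(x, y) \<in> snd (grid_frame k Q) \<longleftrightarrow> edge k Q x y"
  by (simp_all add: grid_frame_def)

text \<open>\<open>Root\<close> sees \<open>Env\<close> points and these see \<open>Root\<close>, so
  neither kind has gadgets as its only successors.\<close>

lemma holds_chain [simp]: "holds (grid_frame k Q) S x (chain n) \<longleftrightarrow> x = Gadget n"
proof (induction n arbitrary: S x)
  case 0
  show ?case
  proof (cases x)
    case (Gadget n)
    then show ?thesis by (cases n) auto
  qed (auto intro: exI[of _ "Gadget 0"])
next
  case (Suc n)
  have "holds (grid_frame k Q) S x (chain (Suc n))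
      \<longleftrightarrow> edge k Q x (Gadget n) \<and> (\<forall>y. edge k Q x y \<longrightarrow> y = Gadget n)"
    using Suc by auto
  also have "\<dots> \<longleftrightarrow> x = Gadget (Suc n)"
  proof (cases x)
    case Root
    have "edge k Q Root (Env undefined)" by simp
    with Root show ?thesis by blast
  next
    case (Env \<nu>)
    have "edge k Q (Env \<nu>) Root" by simp
    with Env show ?thesis by blast
  qed auto
  finally show ?case .
qed

lemma tagged_grid_frame [simp]: "tagged (grid_frame k Q) x j \<longleftrightarrow> j \<in> tags k Q x"
  unfolding tagged_def tag_def holds.simps(2,3) holds_chain by (cases x) auto

lemma coloured_grid_frame:
  "c < 2 * k + 2 \<Longrightarrow> coloured k (grid_frame k Q) x c
    \<longleftrightarrow> x = Root \<and> c = 2 * k + 1 \<or> (\<exists>\<nu>. x = Env \<nu> \<and> env_colour k \<nu> = c)"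
proof (cases x)
  case (Env \<nu>)
  have "Suc (2 * a) \<noteq> 2 * b" for a b :: nat by presburger
  with Env show "c < 2 * k + 2 \<Longrightarrow> ?thesis" by (auto simp: coloured_def)
qed (auto simp: coloured_def)

lemma coloured_grid_frame_simps [simp]:
  "c < Suc (2 * k) \<Longrightarrow> coloured k (grid_frame k Q) (Env \<nu>) c \<longleftrightarrow> env_colour k \<nu> = c"
  "coloured k (grid_frame k Q) x (Suc (2 * k)) \<longleftrightarrow> x = Root"
proof -
  have "env_colour k \<nu> \<noteq> Suc (2 * k)" for \<nu> using env_colour_less[of k \<nu>] by linarith
  then show "coloured k (grid_frame k Q) x (Suc (2 * k)) \<longleftrightarrow> x = Root"
    by (auto simp: coloured_grid_frame)
qed (auto simp: coloured_grid_frame)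

lemma nxt_less_Suc [simp]: "nxt k i c < Suc (2 * k)"
  using nxt_less[of k i c] by simp

lemma tagged_Env [simp]: "tagged (grid_frame k Q) (Env \<nu>) (2 * a) \<longleftrightarrow> \<nu> \<in> Q a"
proof -
  have "2 * a \<noteq> Suc (2 * b)" for b by presburger
  then show ?thesis by auto
qed

text \<open>The colour excludes \<open>Root\<close> and the gadgets, and \<open>nxt_inj\<close>
  recovers the direction.\<close>

lemma edge_coloured:
  assumes "i < k"
  shows "edge k Q (Env \<nu>) t \<and> coloured k (grid_frame k Q) t (nxt k i (env_colour k \<nu>))
    \<longleftrightarrow> t = Env (incr i \<nu>)"
proof
  assume *: "edge k Q (Env \<nu>) t \<and> coloured k (grid_frame k Q) t (nxt k i (env_colour k \<nu>))"
  moreover have "nxt k i (env_colour k \<nu>) < 2 * k + 1" by (rule nxt_less)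
  ultimately obtain \<mu> where \<mu>: "t = Env \<mu>" "env_colour k \<mu> = nxt k i (env_colour k \<nu>)"
    using coloured_grid_frame[of "nxt k i (env_colour k \<nu>)" k Q t] by auto
  with * obtain j where "j < k" "\<mu> = incr j \<nu>" by auto
  with \<mu> assms show "t = Env (incr i \<nu>)"
    using nxt_inj[OF \<open>j < k\<close> assms env_colour_less] by (simp add: env_colour_incr)
qed (use assms in \<open>auto simp: env_colour_incr\<close>)

lemma holds_Back_grid_frame:
  "holds (grid_frame k Q) S (Env \<nu>) (Back k \<phi>)
    \<longleftrightarrow> Root \<in> S \<and> holds (grid_frame k Q) (insert (Env \<nu>) S) Root \<phi>"
  by (simp add: Back_def)

lemma incr_commute: "incr i (incr j \<nu>) = incr j (incr i \<nu>)"
  by (auto simp: incr_def fun_eq_iff)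

text \<open>Coloured steps have exactly one target, so \<open>box\<close> and \<open>dia\<close>
  turn each modality into a single move, and \<open>Root\<close> can revisit any remembered grid
  point. The square closes because increments commute.\<close>

lemma grid_complete:
  assumes ij: "i < k" "j < k"
  shows "holds (grid_frame k Q) {Root} (Env \<nu>) (grid k i j (env_colour k \<nu>))"
proof -
  let ?M = "grid_frame k Q" and ?c = "env_colour k \<nu>"
  have box: "holds ?M S (Env \<mu>) (Box (Imp (colour k (nxt k i (env_colour k \<mu>))) \<phi>))
      \<longleftrightarrow> holds ?M (insert (Env \<mu>) S) (Env (incr i \<mu>)) \<phi>" if "i < k" for S \<mu> \<phi> i
  proof -
    have "holds ?M S (Env \<mu>) (Box (Imp (colour k (nxt k i (env_colour k \<mu>))) \<phi>))
        \<longleftrightarrow> (\<forall>t. edge k Q (Env \<mu>) t \<and> coloured k ?M t (nxt k i (env_colour k \<mu>))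
          \<longrightarrow> holds ?M (insert (Env \<mu>) S) t \<phi>)"
      by (simp add: imp_conjL)
    then show ?thesis unfolding edge_coloured[OF that] by simp
  qed
  have dia: "holds ?M S (Env \<mu>) (Dia (Conj (colour k (nxt k i (env_colour k \<mu>))) \<phi>))
      \<longleftrightarrow> holds ?M (insert (Env \<mu>) S) (Env (incr i \<mu>)) \<phi>" if "i < k" for S \<mu> \<phi> i
  proof -
    have "holds ?M S (Env \<mu>) (Dia (Conj (colour k (nxt k i (env_colour k \<mu>))) \<phi>))
        \<longleftrightarrow> (\<exists>t. (edge k Q (Env \<mu>) t \<and> coloured k ?M t (nxt k i (env_colour k \<mu>)))
          \<and> holds ?M (insert (Env \<mu>) S) t \<phi>)"
      by simp
    then show ?thesis unfolding edge_coloured[OF that] by simp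
  qed
  have root: "holds ?M S Root (Dia (Conj (Conj Known (colour k c)) \<phi>))"
    if "Env \<mu> \<in> S" "Root \<in> S" "env_colour k \<mu> = c" "holds ?M S (Env \<mu>) \<phi>" for S \<mu> \<phi> c
    using that env_colour_less[of k \<mu>] by (auto simp: insert_absorb intro!: exI[of _ "Env \<mu>"])
  have root': "holds ?M S Root (Dia (Conj Known (colour k c)))"
    if "Env \<mu> \<in> S" "Root \<in> S" "env_colour k \<mu> = c" for S \<mu> c
    using that env_colour_less[of k \<mu>] by (auto intro!: exI[of _ "Env \<mu>"])
  have known: "holds ?M S (Env \<nu>) (Box (Imp (colour k (nxt k i ?c)) Known))"
    if "Env (incr i \<nu>) \<in> S" for S
    unfolding box[OF ij(1)] using that by simp
  have "holds ?M {Root} (Env \<nu>) (Dia (colour k (nxt k i ?c)))"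
    using ij by (auto simp: env_colour_incr intro!: exI[of _ "Env (incr i \<nu>)"])
  moreover have "holds ?M {Root} (Env \<nu>) (Box (Imp (colour k (nxt k i ?c)) (Back k (Conj
       (Dia (Conj Known (colour k (nxt k i ?c))))
       (Dia (Conj (Conj Known (colour k ?c)) (Box (Imp (colour k (nxt k i ?c)) Known))))))))"
    unfolding box[OF ij(1)] holds_Back_grid_frame holds.simps(2)
    by (intro conjI root[of \<nu>] root'[of "incr i \<nu>"] known) (simp_all add: env_colour_incr ij)
  moreover have "holds ?M {Root} (Env \<nu>)
     (Box (Imp (colour k (nxt k i ?c)) (Box (Imp (colour k (nxt k j (nxt k i ?c))) (Back k
       (Dia (Conj (Conj Known (colour k ?c)) (Dia (Conj (colour k (nxt k j ?c))
         (Dia (Conj Known (colour k (nxt k j (nxt k i ?c))))))))))))))"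
  proof -
    \<comment> \<open>\<open>?S\<close> is the memory once the evaluation has jumped back from
      \<open>?u\<close> to \<open>Root\<close>.\<close>
    let ?u = "incr j (incr i \<nu>)" and ?S = "{Env (incr j (incr i \<nu>)), Env (incr i \<nu>), Env \<nu>, Root}"
    have "edge k Q (Env (incr j \<nu>)) (Env ?u)" using ij incr_commute by auto
    moreover have "env_colour k ?u = nxt k j (nxt k i ?c)" using ij by (simp add: env_colour_incr)
    ultimately have "holds ?M ?S (Env (incr j \<nu>)) (Dia (Conj Known (colour k (nxt k j (nxt k i ?c)))))"
      unfolding holds.simps holds_colour grid_frame_simps by (intro bexI[of _ "Env ?u"] conjI) simp_all
    then have "holds ?M ?S (Env \<nu>) (Dia (Conj (colour k (nxt k j ?c))
         (Dia (Conj Known (colour k (nxt k j (nxt k i ?c)))))))"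
      unfolding dia[OF ij(2)] by (simp add: insert_absorb)
    then have "holds ?M ?S Root (Dia (Conj (Conj Known (colour k ?c)) (Dia (Conj (colour k (nxt k j ?c))
         (Dia (Conj Known (colour k (nxt k j (nxt k i ?c)))))))))"
      by (intro root) simp_all
    moreover have box2: "holds ?M S (Env (incr i \<nu>)) (Box (Imp (colour k (nxt k j (nxt k i ?c))) \<phi>))
        \<longleftrightarrow> holds ?M (insert (Env (incr i \<nu>)) S) (Env ?u) \<phi>" for S \<phi>
      using box[OF ij(2), of S "incr i \<nu>" \<phi>] by (simp only: env_colour_incr[OF ij(1)])
    ultimately show ?thesis
      unfolding box[OF ij(1)] box2 holds_Back_grid_frame by (intro conjI) simp_all
  qed
  ultimately show ?thesis
    unfolding grid_def holds_Conjs list.set ball_simps by (intro conjI TrueI)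
qed

lemma rule_complete:
  assumes "closed {(\<nu>, a). \<nu> \<in> Q a} r" "dims_below k r"
  shows "holds (grid_frame k Q) S (Env \<nu>) (rule_fm k (env_colour k \<nu>) r)"
proof (cases r)
  case (Up i a b)
  then have *: "\<nu> \<in> Q a \<longrightarrow> incr i \<nu> \<in> Q b" and "i < k" using assms by (simp_all add: closed.simps)
  have "tagged (grid_frame k Q) t (2 * b)" if "\<nu> \<in> Q a" "edge k Q (Env \<nu>) t"
    "coloured k (grid_frame k Q) t (nxt k i (env_colour k \<nu>))" for t
  proof -
    have "t = Env (incr i \<nu>)" using that(2,3) edge_coloured[OF \<open>i < k\<close>] by blast
    with * that(1) show ?thesis by (simp only: tagged_Env)
  qed
  then show ?thesis
    unfolding Up rule_fm.simps holds_Imp holds_Box holds_tag holds_colour grid_frame_simps tagged_Env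
    by blast
next
  case (Down i a b)
  then have *: "incr i \<nu> \<in> Q a \<longrightarrow> \<nu> \<in> Q b" and "i < k" using assms by (simp_all add: closed.simps)
  have "\<nu> \<in> Q b" if "edge k Q (Env \<nu>) t" "tagged (grid_frame k Q) t (2 * a)"
    "coloured k (grid_frame k Q) t (nxt k i (env_colour k \<nu>))" for t
  proof -
    have "t = Env (incr i \<nu>)" using that(1,3) edge_coloured[OF \<open>i < k\<close>] by blast
    with * that(2) show ?thesis by (simp only: tagged_Env)
  qed
  then show ?thesis
    unfolding Down rule_fm.simps holds_Imp holds.simps(2,3) holds_tag holds_colour grid_frame_simps tagged_Env
    by blast
next
  case (And a b d)
  then have "\<nu> \<in> Q a \<and> \<nu> \<in> Q b \<longrightarrow> \<nu> \<in> Q d" using assms by (simp add: closed.simps)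
  then show ?thesis unfolding And rule_fm.simps holds_Imp holds.simps(2) holds_tag tagged_Env .
qed simp

lemma program_complete:
  assumes "\<And>r. r \<in> set rs \<Longrightarrow> closed {(\<nu>, a). \<nu> \<in> Q a} r" "\<And>r. r \<in> set rs \<Longrightarrow> dims_below k r"
  shows "holds (grid_frame k Q) {} Root (program_fm k rs)"
proof -
  let ?M = "grid_frame k Q"
  have start: "holds ?M S (Env (\<lambda>_. 0)) (start_fm r)" if "r \<in> set rs" for r S
    using assms(1)[OF that] by (cases r) (auto simp: closed.simps)
  have "env_colour k (\<lambda>_. 0) = 0" by (simp add: env_colour_def)
  then have "holds ?M {} Root (Dia (Conj (colour k 0) (Conjs (map start_fm rs))))"
    using start by (auto intro!: exI[of _ "Env (\<lambda>_. 0)"])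
  moreover have "holds ?M {Root} t (Imp (colour k c) (Conj
       (Conjs [grid k i j c. i \<leftarrow> [0..<k], j \<leftarrow> [0..<k]]) (Conjs (map (rule_fm k c) rs))))"
    if "c < 2 * k + 1" for c t
  proof -
    have "coloured k ?M t c \<Longrightarrow> \<exists>\<nu>. t = Env \<nu> \<and> env_colour k \<nu> = c"
      using that by (auto simp: coloured_grid_frame)
    then show ?thesis using assms grid_complete rule_complete
      unfolding holds_Imp holds.simps(2) holds_Conjs by auto
  qed
  ultimately show ?thesis
    unfolding program_fm_def holds_Conjs by (auto simp del: upt_Suc holds.simps(2,3) holds_Imp)
qed

text \<open>Label \<open>0\<close> occurs only on the first axis, so every step goes in direction
  \<open>0\<close>: any other direction leaves the axis, and neither \<open>Root\<close> nor a
  gadget carries the label.\<close>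

lemma holds_walkD:
  assumes "Q 0 = {\<nu>. \<forall>i > 0. \<nu> i = 0}"
    and "holds (grid_frame k Q) S (Env (axis_env m)) (walk n)"
  shows "axis_env (m + n) \<in> Q 2"
  using assms(2)
proof (induction n arbitrary: m S)
  case 0
  then show ?case using tagged_Env[of k Q _ 2] by simp
next
  case (Suc n)
  let ?\<nu> = "axis_env m"
  obtain t where t: "edge k Q (Env ?\<nu>) t" "tagged (grid_frame k Q) t (2 * 0)"
      "holds (grid_frame k Q) (S \<union> {Env ?\<nu>}) t (walk n)"
    using Suc.prems unfolding walk.simps holds.simps(2,3) holds_tag grid_frame_simps by blast
  have "t \<noteq> Root" using t(2) by auto
  then obtain i where i: "i < k" "t = Env (incr i ?\<nu>)" using t(1,2) by (cases t) auto
  then have "incr i ?\<nu> \<in> Q 0" using t(2) by (simp only: tagged_Env)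
  then have "\<forall>j > 0. incr i ?\<nu> j = 0" by (simp only: assms(1) mem_Collect_eq)
  moreover have "incr i ?\<nu> i \<noteq> 0" by (simp add: incr_def)
  ultimately have "\<not> i > 0" by metis
  then have "i = 0" by simp
  with i(2) have "t = Env (axis_env (Suc m))" by (simp only: incr_axis_env)
  with t(3) have "holds (grid_frame k Q) (S \<union> {Env ?\<nu>}) (Env (axis_env (Suc m))) (walk n)" by simp
  then have "axis_env (Suc m + n) \<in> Q 2" by (rule Suc.IH)
  then show ?case by (simp only: add_Suc_shift)
qed

section \<open>Correctness of the reduction\<close>

lemma satisfiableI:
  fixes M :: "'a frame"
  assumes "is_frame M" "w \<in> fst M" "holds M {} w \<phi>"
  shows "satisfiable TYPE('a) \<phi>"
  unfolding satisfiable_def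
  by (rule exI[of _ "fst M"], rule exI[of _ "snd M"]) (use assms in \<open>simp, blast\<close>)

text \<open>If \<open>f\<close> maps \<open>n\<close> to \<open>1\<close>, the forced label
  \<open>2\<close> at \<open>axis_env n\<close> provides, in every model of \<open>\<theta>\<close>,
  the walk that \<open>input_fm n\<close> forbids. Otherwise the intended model has no such
  walk.\<close>

theorem reduction:
  assumes "infinite (UNIV :: 'a set)"
  obtains \<theta> where "\<And>n. satisfiable TYPE('a) (Conj \<theta> (input_fm n)) \<longleftrightarrow> \<not> computes f [n] 1"
proof -
  define A where "A = {\<nu> :: env. computes f [\<nu> 0] 1}"
  \<comment> \<open>The value \<open>1\<close> is expressed as the successor of a variable that is
    zero.\<close>
  have "horn_def {\<nu>. \<exists>m. \<nu>(1 := m) \<in> graph f [0] 1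
      \<inter> {\<nu>. \<exists>n. \<nu>(2 := n) \<in> {\<nu>. \<nu> 1 = Suc (\<nu> 2)} \<inter> {\<nu>. \<nu> 2 = 0}}}"
    by (intro horn_def_project horn_def_Int horn_def_graph horn_def_Suc_eq horn_def_zero) simp
  also have "{\<nu>. \<exists>m. \<nu>(1 := m) \<in> graph f [0] 1
      \<inter> {\<nu>. \<exists>n. \<nu>(2 := n) \<in> {\<nu>. \<nu> 1 = Suc (\<nu> 2)} \<inter> {\<nu>. \<nu> 2 = 0}}} = A"
    by (auto simp: A_def graph_def)
  finally have "horn_def A" .
  then obtain k T Q where k: "0 < k" and T: "finite T"
    "\<And>r. r \<in> T \<Longrightarrow> dims_below k r" "\<And>r. r \<in> T \<Longrightarrow> closed {(\<nu>, a :: nat). \<nu> \<in> Q a} r"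
    and Q: "Q 0 = {\<nu>. \<forall>i > 0. \<nu> i = 0}" "Q 1 = {\<lambda>_. 0}" "Q 2 = A"
    and sub: "{Start 0, Start 1, Up 0 0 0} \<subseteq> T"
    and forced: "\<And>L \<nu>. \<forall>r \<in> T. closed L r \<Longrightarrow> supported k \<nu> \<Longrightarrow> \<nu> \<in> A \<Longrightarrow> (\<nu>, 2) \<in> L"
    by (rule horn_program) (rule that)
  obtain rs where rs: "set rs = T" using T(1) finite_list by auto
  define \<theta> where "\<theta> = program_fm k rs"
  have at: "(axis_env n \<in> A) \<longleftrightarrow> computes f [n] 1" for n by (simp add: A_def)
  show thesis
  proof
    fix n
    show "satisfiable TYPE('a) (Conj \<theta> (input_fm n)) \<longleftrightarrow> \<not> computes f [n] 1"
    proof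
      assume "satisfiable TYPE('a) (Conj \<theta> (input_fm n))"
      then obtain W R and s :: 'a where W: "R \<subseteq> W \<times> W"
        and M: "holds (W, R) {} s (program_fm k rs)" and I: "holds (W, R) {} s (input_fm n)"
        by (auto simp: satisfiable_def \<theta>_def)
      obtain E where E: "\<And>\<nu>. (s, E \<nu>) \<in> R" "\<And>i \<nu>. i < k \<Longrightarrow> (E \<nu>, E (incr i \<nu>)) \<in> R"
        "\<And>r. r \<in> set rs \<Longrightarrow> closed {(\<nu>, a). tagged (W, R) (E \<nu>) (2 * a)} r"
        using program_sound[OF W M k] T(2) rs by blast
      let ?L = "{(\<nu>, a). tagged (W, R) (E \<nu>) (2 * a)}"
      have st: "(\<lambda>_. 0, 0) \<in> ?L" "(\<lambda>_. 0, 1) \<in> ?L"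
        using sub E(3) rs closed_StartD[of ?L] by blast+
      have up: "closed ?L (Up 0 0 0)" using sub E(3) rs by blast
      have axis: "(axis_env m, 0) \<in> ?L" for m
      proof (induction m)
        case 0
        show ?case unfolding axis_env_0 by (rule st(1))
      next
        case (Suc m)
        from closed_UpD[OF up this] show ?case by (simp only: incr_axis_env)
      qed
      show "\<not> computes f [n] 1"
      proof
        assume "computes f [n] 1"
        then have "axis_env n \<in> A" by (simp only: at)
        moreover have "supported k (axis_env n)" using k by (auto simp: supported_def)
        ultimately have "(axis_env (0 + n), 2) \<in> ?L"
          using forced[of ?L] E(3) rs by simp
        with axis have "holds (W, R) {s} (E (axis_env 0)) (walk n)"
          using E(2)[OF k] W by (intro holds_walkI) auto
        then have "holds (W, R) {s} (E (\<lambda>_. 0)) (walk n)" unfolding axis_env_0 .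
        moreover have "(s, E (\<lambda>_. 0)) \<in> R" by (rule E(1))
        moreover have "tagged (W, R) (E (\<lambda>_. 0)) (2 * 1)" using st(2) by simp
        ultimately have "holds (W, R) {} s (Dia (Conj (label 1) (walk n)))"
          using W unfolding holds.simps holds_tag fst_conv snd_conv Un_empty_left by blast
        with I show False unfolding input_fm_def holds.simps(1) by contradiction
      qed
    next
      assume f: "\<not> computes f [n] 1"
      let ?M = "grid_frame k Q"
      have "holds ?M {} Root \<theta>"
        unfolding \<theta>_def using program_complete[of rs Q k] T(2,3) rs by blast
      moreover have "holds ?M {} Root (input_fm n)"
      proof (rule ccontr)
        assume "\<not> ?thesis"
        then obtain t where t: "edge k Q Root t" "tagged ?M t (2 * 1)" "holds ?M {Root} t (walk n)"
          unfolding input_fm_def holds.simps(1-3) holds_tag grid_frame_simps Un_empty_left by blast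
        then obtain \<nu> where \<nu>: "t = Env \<nu>" by (cases t) auto
        then have "\<nu> \<in> Q 1" using t(2) by (simp only: tagged_Env)
        then have "\<nu> = axis_env 0" unfolding Q axis_env_0 by (rule singletonD)
        then have "holds ?M {Root} (Env (axis_env 0)) (walk n)" using t(3) \<nu> by blast
        from holds_walkD[OF Q(1) this] have "axis_env n \<in> A" unfolding Q add_0 .
        with f at show False by blast
      qed
      ultimately have "holds ?M {} Root (Conj \<theta> (input_fm n))" unfolding holds.simps(2) by (rule conjI)
      \<comment> \<open>The intended model has uncountably many states;
        \<open>satisfiable_transfer\<close> moves it to the given infinite type.\<close>
      then have "satisfiable TYPE(node) (Conj \<theta> (input_fm n))"
        by (rule satisfiableI[rotated 2]) (simp_all add: grid_frame_def)
      then show "satisfiable TYPE('a) (Conj \<theta> (input_fm n))"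
        using assms by (rule satisfiable_transfer)
    qed
  qed
qed


section \<open>Diagonalisation\<close>

primrec const_rf :: "nat \<Rightarrow> recf" where
  "const_rf 0 = Zero"
| "const_rf (Suc n) = Comp Succ [const_rf n]"

lemma computes_Comp1: "computes g xs y \<Longrightarrow> computes f [y] z \<Longrightarrow> computes (Comp f [g]) xs z"
  by (rule computes.comp[of _ _ "[y]"]) auto

lemma computes_Comp2:
  "computes g xs y \<Longrightarrow> computes g' xs y' \<Longrightarrow> computes f [y, y'] z \<Longrightarrow> computes (Comp f [g, g']) xs z"
  by (rule computes.comp[of _ _ "[y, y']"]) auto

lemma computes_Proj_0: "computes (Proj 0) (x # xs) x"
  using computes.proj[of 0 "x # xs"] by simp

lemma computes_Proj_1: "computes (Proj 1) (x # y # xs) y"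
  using computes.proj[of 1 "x # y # xs"] by simp

lemma computes_const: "computes (const_rf n) xs n"
  by (induction n) (auto intro: computes.zero computes.succ computes_Comp1)

definition "add_rf = Prim (Proj 0) (Comp Succ [Proj 1])"
definition "triangle_rf = Prim Zero (Comp Succ [Comp add_rf [Proj 0, Proj 1]])"
text \<open>\<open>prod_encode (m, n)\<close> is \<open>triangle (m + n) + m\<close>.\<close>

definition "pair_rf = Comp add_rf [Comp triangle_rf [add_rf], Proj 0]"
definition "triple_rf = Comp add_rf [Comp add_rf [Proj 0, Proj 0], Proj 0]"
text \<open>Compound formulas have codes \<open>Suc (3 * n + i)\<close> with \<open>i\<close> equal
  to 0, 1 or 2, so \<open>dia_rf\<close> and \<open>conj_rf\<close> arise from \<open>neg_rf\<close>
  by one and two further successors.\<close>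

definition "neg_rf = Comp Succ [triple_rf]"
definition "dia_rf = Comp Succ [neg_rf]"
definition "conj_rf = Comp Succ [Comp Succ [Comp neg_rf [pair_rf]]]"
definition "walk_rf = Prim (const_rf (code (walk 0))) (Comp dia_rf [Comp conj_rf [const_rf (code (label 0)), Proj 1]])"
text \<open>The argument is used twice, as the code of \<open>\<theta>\<close> and as the input
  number; this is the diagonal.\<close>

definition "instance_rf = Comp conj_rf
  [Proj 0, Comp neg_rf [Comp dia_rf [Comp conj_rf [const_rf (code (label 1)), walk_rf]]]]"

lemma computes_add: "computes add_rf [m, n] (m + n)"
proof (induction m)
  case 0
  show ?case unfolding add_rf_def by (auto intro: computes.prim_0 computes_Proj_0)
next
  case (Suc m)
  then have "computes (Prim (Proj 0) (Comp Succ [Proj 1])) [m, n] (m + n)" by (simp add: add_rf_def)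
  then have "computes (Prim (Proj 0) (Comp Succ [Proj 1])) [Suc m, n] (Suc (m + n))"
    by (rule computes.prim_Suc) (rule computes_Comp1[OF computes_Proj_1 computes.succ])
  then show ?case by (simp add: add_rf_def)
qed

lemma computes_triangle: "computes triangle_rf [n] (triangle n)"
proof (induction n)
  case 0
  show ?case unfolding triangle_rf_def by (auto intro: computes.prim_0 computes.zero)
next
  case (Suc n)
  have "computes triangle_rf [Suc n] (Suc (n + triangle n))"
    using Suc unfolding triangle_rf_def
    by (rule computes.prim_Suc)
      (rule computes_Comp1[OF computes_Comp2[OF computes_Proj_0 computes_Proj_1 computes_add] computes.succ])
  then show ?case by (simp add: add.commute)
qed

lemma computes_pair: "computes pair_rf [m, n] (prod_encode (m, n))"
  unfolding pair_rf_def prod_encode_def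
  by (auto intro: computes_Comp1 computes_Comp2 computes_add computes_triangle computes_Proj_0)

lemma computes_neg: "computes neg_rf [code \<phi>] (code (Neg \<phi>))"
  and computes_neg': "computes neg_rf [n] (Suc (3 * n))"
proof -
  show *: "computes neg_rf [n] (Suc (3 * n))" for n
  proof -
    have "computes neg_rf [n] (Suc (n + n + n))"
      unfolding neg_rf_def triple_rf_def
      by (rule computes_Comp1[OF computes_Comp2[OF computes_Comp2[OF computes_Proj_0 computes_Proj_0
            computes_add] computes_Proj_0 computes_add] computes.succ])
    then show ?thesis by (simp add: numeral_3_eq_3 add.assoc)
  qed
  from *[of "code \<phi>"] show "computes neg_rf [code \<phi>] (code (Neg \<phi>))" by simp
qed

lemma computes_dia: "computes dia_rf [code \<phi>] (code (Dia \<phi>))"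
  unfolding dia_rf_def using computes_Comp1[OF computes_neg' computes.succ] by simp

lemma computes_conj: "computes conj_rf [code \<phi>, code \<psi>] (code (Conj \<phi> \<psi>))"
  unfolding conj_rf_def
  using computes_Comp1[OF computes_Comp1[OF computes_Comp1[OF computes_pair computes_neg'] computes.succ] computes.succ]
  by simp

lemma computes_walk: "computes walk_rf [n] (code (walk n))"
proof (induction n)
  case 0
  show ?case unfolding walk_rf_def by (rule computes.prim_0) (rule computes_const)
next
  case (Suc n)
  have "computes walk_rf [Suc n] (code (Dia (Conj (label 0) (walk n))))"
    using Suc unfolding walk_rf_def
    by (rule computes.prim_Suc)
      (rule computes_Comp1[OF computes_Comp2[OF computes_const computes_Proj_1 computes_conj] computes_dia])
  then show ?case by (simp only: walk.simps)
qed

lemma computes_instance: "computes instance_rf [code \<theta>] (code (Conj \<theta> (input_fm (code \<theta>))))"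
  unfolding instance_rf_def input_fm_def
  by (rule computes_Comp2[OF computes_Proj_0 computes_Comp1[OF computes_Comp1[OF
      computes_Comp2[OF computes_const computes_walk computes_conj] computes_dia] computes_neg] computes_conj])

theorem theorem2:
  assumes "infinite (UNIV :: 'a set)"
  shows "\<not> decidable (satisfiable TYPE('a))"
proof
  assume "decidable (satisfiable TYPE('a))"
  then obtain d where d: "\<And>\<phi>. computes d [code \<phi>] (if satisfiable TYPE('a) \<phi> then 1 else 0)"
    by (auto simp: decidable_def)
  \<comment> \<open>\<open>\<theta>\<close> describes the function that runs \<open>d\<close> on the
    instance built from its argument, so that its own code can be fed to it.\<close>
  obtain \<theta> where \<theta>: "\<And>n. satisfiable TYPE('a) (Conj \<theta> (input_fm n))
      \<longleftrightarrow> \<not> computes (Comp d [instance_rf]) [n] 1"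
    using reduction[OF assms] by metis
  define \<phi> where "\<phi> = Conj \<theta> (input_fm (code \<theta>))"
  have c: "computes (Comp d [instance_rf]) [code \<theta>] (if satisfiable TYPE('a) \<phi> then 1 else 0)"
    unfolding \<phi>_def by (rule computes_Comp1[OF computes_instance d])
  show False
  proof (cases "satisfiable TYPE('a) \<phi>")
    case True
    with c have "computes (Comp d [instance_rf]) [code \<theta>] 1" by simp
    with True \<theta>[of "code \<theta>"] show False unfolding \<phi>_def by blast
  next
    case False
    with \<theta>[of "code \<theta>"] have "computes (Comp d [instance_rf]) [code \<theta>] 1"
      unfolding \<phi>_def by blast
    moreover have "computes (Comp d [instance_rf]) [code \<theta>] 0" using c False by simp
    ultimately show ?thesis using computes_deterministic by fastforce
  qed
qed

end
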